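(* Let $\Gamma$ be a finitely generated group with a finite normal subgroup $N$ such that $\Gamma/N$ is hyperlinear. If $\Gamma$ is MF, then $\Gamma$ is hyperlinear.
   Context: For $A \in M_n(\mathbb{C})$, $\|A\|_{\mathrm{op}}$ is the operator norm and $\|A\|_{\mathrm{HS}} = \frac{1}{\sqrt{n}} \operatorname{Tr}(A^*A)^{1/2}$ is the normalized Hilbert--Schmidt norm. Given, for every $n$, a norm $\|\cdot\|$ on $M_n(\mathbb{C})$, a group $\Gamma$ is approximated with respect to $\|\cdot\|$ if there exist maps (not necessarily homomorphisms) $\varphi_n : \Gamma \to U(n)$, $n\in\mathbb{N}$, into the unitary groups such that $\lim_n \|\varphi_n(gh) - \varphi_n(g)\varphi_n(h)\| = 0$ for all $g,h \in \Gamma$ and $\liminf_n \|\varphi_n(g) - 1\| > 0$ for all $g \in \Gamma\setminus\{1\}$. A group is hyperlinear if it is approximated with respect to $\|\cdot\|_{\mathrm{HS}}$, and MF if it is approximated with respect to $\|\cdot\|_{\mathrm{op}}$. *)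

theory Defs
  imports
    "HOL-Algebra.Generated_Groups"
    "HOL-Algebra.Coset"
    "HOL-Library.FuncSet"
    "HOL-Library.Extended_Real"
    "HOL-Library.Liminf_Limsup"
    "Jordan_Normal_Form.Schur_Decomposition"
begin

definition unitary_matrices :: "nat \<Rightarrow> complex mat set" where
  "unitary_matrices n =
     {U \<in> carrier_mat n n. mat_adjoint U * U = 1\<^sub>m n \<and> U * mat_adjoint U = 1\<^sub>m n}"

definition mat_trace :: "complex mat \<Rightarrow> complex" where
  "mat_trace A = (\<Sum>i<dim_row A. A $$ (i, i))"

definition euclidean_norm_vec :: "complex vec \<Rightarrow> real" where
  "euclidean_norm_vec v = sqrt (\<Sum>i<dim_vec v. (cmod (v $ i))\<^sup>2)"

text \<open>
  The two norms on the \<open>n \<times> n\<close> complex matrices; their values are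
  meaningful only for arguments in \<open>carrier_mat n n\<close>.
\<close>

definition op_norm :: "nat \<Rightarrow> complex mat \<Rightarrow> real" where
  "op_norm n A =
     (SUP v \<in> {v \<in> carrier_vec n. euclidean_norm_vec v \<le> 1}. euclidean_norm_vec (A *\<^sub>v v))"

text \<open>The trace of \<open>A\<^sup>* A\<close> is real and nonnegative, so \<open>Re\<close> loses nothing.\<close>

definition hs_norm :: "nat \<Rightarrow> complex mat \<Rightarrow> real" where
  "hs_norm n A = 1 / sqrt (real n) * sqrt (Re (mat_trace (mat_adjoint A * A)))"

text \<open>
  The dimensions range over \<open>n \<ge> 1\<close>; the value of the sequence at index 0 does not
  matter. The lower limit is taken in the extended reals, so that it always exists.
\<close>

definition approximated_wrt ::
    "(nat \<Rightarrow> complex mat \<Rightarrow> real) \<Rightarrow> ('a, 'b) monoid_scheme \<Rightarrow> bool" where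
  "approximated_wrt nrm G \<longleftrightarrow>
     (\<exists>\<phi> :: nat \<Rightarrow> 'a \<Rightarrow> complex mat.
        (\<forall>n\<ge>1. \<phi> n \<in> carrier G \<rightarrow> unitary_matrices n) \<and>
        (\<forall>g\<in>carrier G. \<forall>h\<in>carrier G.
           (\<lambda>n. nrm n (\<phi> n (g \<otimes>\<^bsub>G\<^esub> h) - \<phi> n g * \<phi> n h)) \<longlonglongrightarrow> 0) \<and>
        (\<forall>g\<in>carrier G - {\<one>\<^bsub>G\<^esub>}.
           liminf (\<lambda>n. ereal (nrm n (\<phi> n g - 1\<^sub>m n))) > 0))"

definition hyperlinear :: "('a, 'b) monoid_scheme \<Rightarrow> bool" where
  "hyperlinear G \<longleftrightarrow> approximated_wrt hs_norm G"

definition MF_group :: "('a, 'b) monoid_scheme \<Rightarrow> bool" where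
  "MF_group G \<longleftrightarrow> approximated_wrt op_norm G"

definition finitely_generated_group :: "('a, 'b) monoid_scheme \<Rightarrow> bool" where
  "finitely_generated_group G \<longleftrightarrow>
     (\<exists>S. finite S \<and> S \<subseteq> carrier G \<and> generate G S = carrier G)"

end

theory Submission
  imports Defs "Jordan_Normal_Form.Spectral_Radius" "HOL-Analysis.L2_Norm"
begin

text \<open>
  Asymptotic representations into the unitary groups can be added: the direct sum of two of them
  separates from \<open>1\<close>, in the normalized Hilbert--Schmidt norm, every element that one of the two
  separates (\<open>hs_direct_sum\<close>). Since \<open>N\<close> is finite and the elements outside \<open>N\<close> are separated
  through the quotient, it suffices to separate a single \<open>h \<in> N\<close> with \<open>h \<noteq> 1\<close>.

  Let \<open>\<phi>\<close> be an asymptotic representation in operator norm, with \<open>\<phi>\<^sub>n(h)\<close> bounded away from \<open>1\<close>.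
  In Hilbert--Schmidt norm \<open>\<phi>\<^sub>n(h)\<close> may still tend to \<open>1\<close>, because it may act nontrivially
  on a small part of the space only. The remedy is to cut down to that part. Let \<open>M \<subseteq> N\<close> be the normal
  closure of \<open>h\<close>. The average of \<open>\<phi>\<^sub>n\<close> over the finite normal subgroup \<open>M\<close> is asymptotically a
  projection commuting with all \<open>\<phi>\<^sub>n(g)\<close>. The complementary projection is nonzero for large \<open>n\<close>, and
  compression to its range, followed by rounding to unitary matrices, gives an asymptotic
  representation \<open>\<psi>\<close> in operator norm for which the sum of all \<open>\<psi>\<^sub>n(x)\<close> with \<open>x \<in> M\<close> tends
  to \<open>0\<close> (\<open>compression\<close>). The rounding is by the spectral theorem (\<open>almost_projection_range\<close>,
  \<open>almost_unitary_near_unitary\<close>).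

  The elements that \<open>\<psi>\<close> sends close to \<open>1\<close> in Hilbert--Schmidt norm whenever it does so with \<open>h\<close>
  form a normal subgroup, which contains \<open>M\<close>. If \<open>\<psi>\<^sub>n(h)\<close> were close to \<open>1\<close>, the sum over \<open>M\<close>
  would thus be close to \<open>|M|\<close> times the identity instead of \<open>0\<close>; so \<open>\<psi>\<close> separates \<open>h\<close>
  (\<open>hs_separates_normal_generator\<close>). Finally \<open>\<psi>\<^sub>n\<close> lives in some dimension \<open>d \<le> n\<close>; repeating it
  as often as possible fills at least half of dimension \<open>n\<close> (\<open>hs_amplification\<close>).
\<close>

section \<open>Adjoints, unitary matrices and the Euclidean norm\<close>

lemma mat_adjoint_eq:
  "mat_adjoint A = mat (dim_col A) (dim_row A) (\<lambda>(i, j). cnj (A $$ (j, i)))"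
  by (rule eq_matI) (auto simp: mat_adjoint_def mat_of_rows_index)

lemma mat_adjoint_dim [simp]:
  "dim_row (mat_adjoint (A :: complex mat)) = dim_col A" "dim_col (mat_adjoint A) = dim_row A"
  by (auto simp: mat_adjoint_eq)

lemma mat_adjoint_carrier [simp, intro]:
  "(A :: complex mat) \<in> carrier_mat m n \<Longrightarrow> mat_adjoint A \<in> carrier_mat n m"
  by (metis mat_adjoint_dim carrier_matD carrier_matI)

lemma mat_adjoint_index [simp]:
  "i < dim_col A \<Longrightarrow> j < dim_row A \<Longrightarrow> mat_adjoint A $$ (i, j) = cnj (A $$ (j, i))"
  by (auto simp: mat_adjoint_eq)

lemma mat_adjoint_adjoint [simp]: "mat_adjoint (mat_adjoint A) = (A :: complex mat)"
  by (rule eq_matI) auto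

lemma mat_adjoint_one [simp]: "mat_adjoint (1\<^sub>m n) = (1\<^sub>m n :: complex mat)"
  by (rule eq_matI) auto

lemma mat_adjoint_mult:
  fixes A B :: "complex mat"
  assumes "A \<in> carrier_mat m n" "B \<in> carrier_mat n k"
  shows "mat_adjoint (A * B) = mat_adjoint B * mat_adjoint A"
  using assms by (intro eq_matI) (auto simp: scalar_prod_def mult.commute intro!: sum.cong)

lemma mat_adjoint_diff:
  fixes A B :: "complex mat"
  assumes "A \<in> carrier_mat m n" "B \<in> carrier_mat m n"
  shows "mat_adjoint (A - B) = mat_adjoint A - mat_adjoint B"
  using assms by (intro eq_matI) auto

lemma mat_adjoint_smult:
  fixes A :: "complex mat"
  shows "mat_adjoint (c \<cdot>\<^sub>m A) = cnj c \<cdot>\<^sub>m mat_adjoint A"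
  by (intro eq_matI) auto

lemma unitary_matricesD:
  assumes "U \<in> unitary_matrices n"
  shows "U \<in> carrier_mat n n" "mat_adjoint U * U = 1\<^sub>m n" "U * mat_adjoint U = 1\<^sub>m n"
  using assms by (auto simp: unitary_matrices_def)

lemma unitary_matricesI:
  assumes "U \<in> carrier_mat n n" "mat_adjoint U * U = 1\<^sub>m n"
  shows "U \<in> unitary_matrices n"
  using assms mat_mult_left_right_inverse[of "mat_adjoint U" n U]
  by (auto simp: unitary_matrices_def)

lemma unitary_matrices_one: "1\<^sub>m n \<in> unitary_matrices n"
  by (rule unitary_matricesI) auto

lemma unitary_matrices_adjoint: "U \<in> unitary_matrices n \<Longrightarrow> mat_adjoint U \<in> unitary_matrices n"
  by (auto simp: unitary_matrices_def)

lemma unitary_matrices_mult: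
  assumes "U \<in> unitary_matrices n" "W \<in> unitary_matrices n"
  shows "U * W \<in> unitary_matrices n"
proof (rule unitary_matricesI)
  note U = unitary_matricesD[OF assms(1)] and W = unitary_matricesD[OF assms(2)]
  show "U * W \<in> carrier_mat n n" using U W by auto
  have "mat_adjoint (U * W) * (U * W) = mat_adjoint W * ((mat_adjoint U * U) * W)"
    unfolding mat_adjoint_mult[OF U(1) W(1)] using U(1) W(1)
    by (smt (verit) assoc_mult_mat mat_adjoint_carrier mult_carrier_mat)
  then show "mat_adjoint (U * W) * (U * W) = 1\<^sub>m n" using U W by auto
qed

lemma euclidean_norm_vec_L2: "euclidean_norm_vec v = L2_set (\<lambda>i. cmod (v $ i)) {..<dim_vec v}"
  by (simp add: euclidean_norm_vec_def L2_set_def)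

lemma euclidean_norm_vec_nonneg [simp]: "0 \<le> euclidean_norm_vec v"
  by (simp add: euclidean_norm_vec_L2)

lemma euclidean_norm_vec_zero [simp]: "euclidean_norm_vec (0\<^sub>v n) = 0"
  by (simp add: euclidean_norm_vec_L2 L2_set_def)

lemma euclidean_norm_vec_unit: "i < n \<Longrightarrow> euclidean_norm_vec (unit_vec n i) = 1"
  by (simp add: euclidean_norm_vec_def if_distrib[of cmod] if_distrib[of "\<lambda>x. x^2"] cong: if_cong)

lemma euclidean_norm_vec_smult: "euclidean_norm_vec (c \<cdot>\<^sub>v v) = cmod c * euclidean_norm_vec v"
proof -
  have "L2_set (\<lambda>i. cmod ((c \<cdot>\<^sub>v v) $ i)) {..<dim_vec v} = L2_set (\<lambda>i. cmod c * cmod (v $ i)) {..<dim_vec v}"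
    by (rule L2_set_cong) (auto simp: norm_mult)
  then show ?thesis by (simp add: euclidean_norm_vec_L2 L2_set_right_distrib)
qed

lemma euclidean_norm_vec_triangle:
  assumes "v \<in> carrier_vec n" "w \<in> carrier_vec n"
  shows "euclidean_norm_vec (v + w) \<le> euclidean_norm_vec v + euclidean_norm_vec w"
proof -
  have "euclidean_norm_vec (v + w) \<le> L2_set (\<lambda>i. cmod (v $ i) + cmod (w $ i)) {..<n}"
    using assms by (auto simp: euclidean_norm_vec_L2 intro!: L2_set_mono norm_triangle_ineq)
  also have "\<dots> \<le> euclidean_norm_vec v + euclidean_norm_vec w"
    using assms L2_set_triangle_ineq by (auto simp: euclidean_norm_vec_L2)
  finally show ?thesis .
qed

lemma cscalar_prod_self:
  "v \<bullet>c v = complex_of_real ((euclidean_norm_vec v)\<^sup>2)"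
  by (simp add: scalar_prod_def euclidean_norm_vec_def sum_nonneg lessThan_atLeast0
      flip: complex_norm_square)

lemma cscalar_prod_adjoint:
  fixes A :: "complex mat"
  assumes "A \<in> carrier_mat m n" "v \<in> carrier_vec n" "w \<in> carrier_vec m"
  shows "(A *\<^sub>v v) \<bullet>c w = v \<bullet>c (mat_adjoint A *\<^sub>v w)"
proof -
  have "(A *\<^sub>v v) \<bullet>c w = (\<Sum>i<m. \<Sum>j<n. A $$ (i, j) * v $ j * cnj (w $ i))"
    using assms by (auto simp: scalar_prod_def sum_distrib_right lessThan_atLeast0 intro!: sum.cong)
  also have "\<dots> = (\<Sum>j<n. \<Sum>i<m. A $$ (i, j) * v $ j * cnj (w $ i))"
    by (rule sum.swap)
  also have "\<dots> = v \<bullet>c (mat_adjoint A *\<^sub>v w)"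
    using assms by (auto simp: scalar_prod_def sum_distrib_left lessThan_atLeast0 mult_ac intro!: sum.cong)
  finally show ?thesis .
qed

text \<open>
  The Cauchy--Schwarz inequality.
\<close>

lemma cscalar_prod_le:
  assumes "v \<in> carrier_vec n" "w \<in> carrier_vec n"
  shows "cmod (v \<bullet>c w) \<le> euclidean_norm_vec v * euclidean_norm_vec w"
proof -
  have "cmod (v \<bullet>c w) \<le> (\<Sum>i<n. \<bar>cmod (v $ i)\<bar> * \<bar>cmod (w $ i)\<bar>)"
    using assms by (auto simp: scalar_prod_def norm_mult lessThan_atLeast0 intro!: sum_norm_le)
  also have "\<dots> \<le> euclidean_norm_vec v * euclidean_norm_vec w"
    using assms L2_set_mult_ineq[of "\<lambda>i. cmod (v $ i)" "\<lambda>i. cmod (w $ i)" "{..<n}"]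
    by (auto simp: euclidean_norm_vec_L2)
  finally show ?thesis .
qed

section \<open>Operator bounds\<close>

text \<open>
  A bound for the operator norm as a predicate: it applies to rectangular matrices and needs
  no supremum.
\<close>

definition op_bound :: "complex mat \<Rightarrow> real \<Rightarrow> bool" where
  "op_bound A c \<longleftrightarrow>
     (\<forall>v\<in>carrier_vec (dim_col A). euclidean_norm_vec (A *\<^sub>v v) \<le> c * euclidean_norm_vec v)"

lemma op_boundD:
  "op_bound A c \<Longrightarrow> A \<in> carrier_mat m n \<Longrightarrow> v \<in> carrier_vec n \<Longrightarrow>
     euclidean_norm_vec (A *\<^sub>v v) \<le> c * euclidean_norm_vec v"
  by (auto simp: op_bound_def)

lemma op_bound_mono: "op_bound A c \<Longrightarrow> c \<le> d \<Longrightarrow> op_bound A d"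
  unfolding op_bound_def by (meson euclidean_norm_vec_nonneg mult_right_mono order_trans)

lemma op_bound_zero [simp]: "0 \<le> c \<Longrightarrow> op_bound (0\<^sub>m m n) c"
proof -
  have "0\<^sub>m m n *\<^sub>v v = 0\<^sub>v m" if "v \<in> carrier_vec n" for v :: "complex vec"
    using that by (intro eq_vecI) auto
  then show "0 \<le> c \<Longrightarrow> ?thesis" by (simp add: op_bound_def)
qed

lemma op_bound_add:
  assumes "op_bound A c" "op_bound B d" "A \<in> carrier_mat m n" "B \<in> carrier_mat m n"
  shows "op_bound (A + B) (c + d)"
  unfolding op_bound_def
proof
  fix v :: "complex vec" assume "v \<in> carrier_vec (dim_col (A + B))"
  then have v: "v \<in> carrier_vec n" using assms by auto
  have "(A + B) *\<^sub>v v = A *\<^sub>v v + B *\<^sub>v v" using assms v by (simp add: add_mult_distrib_mat_vec)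
  then have "euclidean_norm_vec ((A + B) *\<^sub>v v) \<le> euclidean_norm_vec (A *\<^sub>v v) + euclidean_norm_vec (B *\<^sub>v v)"
    using euclidean_norm_vec_triangle[OF mult_mat_vec_carrier[OF assms(3) v] mult_mat_vec_carrier[OF assms(4) v]]
    by simp
  also have "\<dots> \<le> (c + d) * euclidean_norm_vec v"
    using op_boundD[OF assms(1,3) v] op_boundD[OF assms(2,4) v] by (simp add: algebra_simps)
  finally show "euclidean_norm_vec ((A + B) *\<^sub>v v) \<le> (c + d) * euclidean_norm_vec v" .
qed

lemma op_bound_smult:
  assumes "op_bound A c"
  shows "op_bound (k \<cdot>\<^sub>m A) (cmod k * c)"
  unfolding op_bound_def
proof
  fix v :: "complex vec" assume "v \<in> carrier_vec (dim_col (k \<cdot>\<^sub>m A))"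
  then have v: "v \<in> carrier_vec (dim_col A)" by auto
  have "(k \<cdot>\<^sub>m A) *\<^sub>v v = k \<cdot>\<^sub>v (A *\<^sub>v v)" using v by (intro eq_vecI) auto
  then show "euclidean_norm_vec ((k \<cdot>\<^sub>m A) *\<^sub>v v) \<le> cmod k * c * euclidean_norm_vec v"
    using assms v by (simp add: euclidean_norm_vec_smult op_bound_def mult.assoc mult_left_mono)
qed

lemma op_bound_minus_commute:
  assumes "op_bound (A - B) c" "A \<in> carrier_mat m n" "B \<in> carrier_mat m n"
  shows "op_bound (B - A) c"
proof -
  have "B - A = (-1) \<cdot>\<^sub>m (A - B)" using assms by (intro eq_matI) auto
  then show ?thesis using op_bound_smult[OF assms(1), of "-1"] by simp
qed

lemma op_bound_mult:
  assumes "op_bound A c" "op_bound B d" "A \<in> carrier_mat m n" "B \<in> carrier_mat n k" "0 \<le> c"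
  shows "op_bound (A * B) (c * d)"
  unfolding op_bound_def
proof
  fix v :: "complex vec" assume "v \<in> carrier_vec (dim_col (A * B))"
  then have v: "v \<in> carrier_vec k" using assms by auto
  have "(A * B) *\<^sub>v v = A *\<^sub>v (B *\<^sub>v v)" using assms v by simp
  moreover have "euclidean_norm_vec (A *\<^sub>v (B *\<^sub>v v)) \<le> c * euclidean_norm_vec (B *\<^sub>v v)"
    using op_boundD[OF assms(1,3)] assms(4) v by auto
  moreover have "c * euclidean_norm_vec (B *\<^sub>v v) \<le> c * (d * euclidean_norm_vec v)"
    using op_boundD[OF assms(2,4) v] assms(5) by (rule mult_left_mono)
  ultimately show "euclidean_norm_vec ((A * B) *\<^sub>v v) \<le> c * d * euclidean_norm_vec v" by simp
qed

text \<open>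
  For \<open>u = A\<^sup>* w\<close> one has \<open>|u|\<^sup>2 = \<langle>A u, w\<rangle> \<le> c |u| |w|\<close>, and \<open>|u|\<close> cancels.
\<close>

lemma op_bound_adjoint:
  assumes "op_bound A c" "A \<in> carrier_mat m n" "0 \<le> c"
  shows "op_bound (mat_adjoint A) c"
  unfolding op_bound_def
proof
  fix w :: "complex vec" assume "w \<in> carrier_vec (dim_col (mat_adjoint A))"
  then have w: "w \<in> carrier_vec m" using assms by auto
  let ?u = "mat_adjoint A *\<^sub>v w"
  have u: "?u \<in> carrier_vec n" using mult_mat_vec_carrier[OF mat_adjoint_carrier[OF assms(2)] w] .
  have "complex_of_real ((euclidean_norm_vec ?u)\<^sup>2) = (A *\<^sub>v ?u) \<bullet>c w"
    using cscalar_prod_adjoint[OF assms(2) u w] by (simp add: cscalar_prod_self)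
  then have "(euclidean_norm_vec ?u)\<^sup>2 = cmod ((A *\<^sub>v ?u) \<bullet>c w)"
    by (metis norm_of_real abs_of_nonneg zero_le_power2)
  also have "\<dots> \<le> euclidean_norm_vec (A *\<^sub>v ?u) * euclidean_norm_vec w"
    by (rule cscalar_prod_le[OF mult_mat_vec_carrier[OF assms(2) u] w])
  also have "\<dots> \<le> c * euclidean_norm_vec ?u * euclidean_norm_vec w"
    using op_boundD[OF assms(1,2) u] by (rule mult_right_mono) simp
  finally have "euclidean_norm_vec ?u * euclidean_norm_vec ?u \<le> euclidean_norm_vec ?u * (c * euclidean_norm_vec w)"
    by (simp add: power2_eq_square mult_ac)
  then show "euclidean_norm_vec ?u \<le> c * euclidean_norm_vec w"
    using assms(3) by (cases "euclidean_norm_vec ?u = 0") (auto simp: less_le)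
qed

lemma euclidean_norm_vec_isometry:
  assumes "A \<in> carrier_mat m n" "mat_adjoint A * A = 1\<^sub>m n" "v \<in> carrier_vec n"
  shows "euclidean_norm_vec (A *\<^sub>v v) = euclidean_norm_vec v"
proof -
  have "(A *\<^sub>v v) \<bullet>c (A *\<^sub>v v) = v \<bullet>c ((mat_adjoint A * A) *\<^sub>v v)"
    using cscalar_prod_adjoint[OF assms(1,3) mult_mat_vec_carrier[OF assms(1,3)]]
      assoc_mult_mat_vec[OF mat_adjoint_carrier[OF assms(1)] assms(1,3)] by simp
  then have "complex_of_real ((euclidean_norm_vec (A *\<^sub>v v))\<^sup>2) = complex_of_real ((euclidean_norm_vec v)\<^sup>2)"
    using assms by (simp add: cscalar_prod_self del: of_real_power)
  then show ?thesis by (simp del: of_real_power)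
qed

lemma op_bound_isometry:
  assumes "A \<in> carrier_mat m n" "mat_adjoint A * A = 1\<^sub>m n"
  shows "op_bound A 1"
  using euclidean_norm_vec_isometry[OF assms] assms by (auto simp: op_bound_def)

lemma op_bound_unitary: "U \<in> unitary_matrices n \<Longrightarrow> op_bound U 1"
  by (auto simp: unitary_matrices_def intro: op_bound_isometry)

lemma op_bound_coisometry:
  assumes "A \<in> carrier_mat m n" "A * mat_adjoint A = 1\<^sub>m m"
  shows "op_bound A 1"
  using op_bound_adjoint[OF op_bound_isometry[OF mat_adjoint_carrier[OF assms(1)]]
    mat_adjoint_carrier[OF assms(1)]] assms(2) by simp

text \<open>Boundedness makes the supremum that defines the operator norm meaningful.\<close>

lemma op_bound_exists: "\<exists>c\<ge>0. op_bound A c"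
proof -
  define c where "c = (\<Sum>i<dim_row A. euclidean_norm_vec (row A i))"
  have "euclidean_norm_vec (A *\<^sub>v v) \<le> c * euclidean_norm_vec v" if v: "v \<in> carrier_vec (dim_col A)" for v
  proof -
    have "euclidean_norm_vec (A *\<^sub>v v) \<le> (\<Sum>i<dim_row A. \<bar>cmod ((A *\<^sub>v v) $ i)\<bar>)"
      unfolding euclidean_norm_vec_L2 dim_mult_mat_vec by (rule L2_set_le_sum_abs)
    also have "\<dots> \<le> (\<Sum>i<dim_row A. euclidean_norm_vec (row A i) * euclidean_norm_vec v)"
    proof (rule sum_mono)
      fix i assume "i \<in> {..<dim_row A}"
      then have "(A *\<^sub>v v) $ i = row A i \<bullet>c conjugate v"
        using v by simp
      moreover have "euclidean_norm_vec (conjugate v) = euclidean_norm_vec v"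
        by (simp add: euclidean_norm_vec_def)
      ultimately show "\<bar>cmod ((A *\<^sub>v v) $ i)\<bar> \<le> euclidean_norm_vec (row A i) * euclidean_norm_vec v"
        using cscalar_prod_le[of "row A i" "dim_col A" "conjugate v"] v by auto
    qed
    finally show ?thesis by (simp add: c_def sum_distrib_right)
  qed
  moreover have "c \<ge> 0" by (auto simp: c_def intro: sum_nonneg)
  ultimately show ?thesis by (auto simp: op_bound_def)
qed

lemma op_norm_bound:
  assumes "A \<in> carrier_mat n n"
  shows "op_bound A (op_norm n A)"
  unfolding op_bound_def
proof
  fix v :: "complex vec" assume "v \<in> carrier_vec (dim_col A)"
  then have v: "v \<in> carrier_vec n" using assms by auto
  obtain c where c: "c \<ge> 0" "op_bound A c" using op_bound_exists by blast
  let ?S = "{v \<in> carrier_vec n. euclidean_norm_vec v \<le> 1}"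
  have bdd: "bdd_above ((\<lambda>v. euclidean_norm_vec (A *\<^sub>v v)) ` ?S)"
  proof (rule bdd_aboveI2)
    fix v assume "v \<in> ?S"
    then show "euclidean_norm_vec (A *\<^sub>v v) \<le> c * 1"
      using op_boundD[OF c(2) assms, of v] c(1)
      by (metis (no_types, lifting) mem_Collect_eq mult_left_mono order_trans)
  qed
  show "euclidean_norm_vec (A *\<^sub>v v) \<le> op_norm n A * euclidean_norm_vec v"
  proof (cases "euclidean_norm_vec v = 0")
    case True
    then show ?thesis using op_boundD[OF c(2) assms v] by simp
  next
    case False
    let ?r = "euclidean_norm_vec v"
    let ?w = "complex_of_real (1 / ?r) \<cdot>\<^sub>v v"
    have r: "?r > 0" using False by (simp add: less_le)
    have "?w \<in> ?S" using v r by (simp add: euclidean_norm_vec_smult norm_divide)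
    then have "euclidean_norm_vec (A *\<^sub>v ?w) \<le> op_norm n A"
      unfolding op_norm_def by (rule cSUP_upper[OF _ bdd])
    moreover have "A *\<^sub>v ?w = complex_of_real (1 / ?r) \<cdot>\<^sub>v (A *\<^sub>v v)"
      using assms v by (rule mult_mat_vec)
    ultimately show ?thesis using r
      by (simp add: euclidean_norm_vec_smult norm_divide field_simps)
  qed
qed

lemma op_norm_le:
  assumes "A \<in> carrier_mat n n" "op_bound A c" "0 \<le> c"
  shows "op_norm n A \<le> c"
  unfolding op_norm_def
proof (rule cSUP_least)
  have "0\<^sub>v n \<in> {v \<in> carrier_vec n. euclidean_norm_vec v \<le> 1}" by simp
  then show "{v \<in> carrier_vec n. euclidean_norm_vec v \<le> 1} \<noteq> {}" by blast
  fix v :: "complex vec" assume "v \<in> {v \<in> carrier_vec n. euclidean_norm_vec v \<le> 1}"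
  then show "euclidean_norm_vec (A *\<^sub>v v) \<le> c"
    using op_boundD[OF assms(2,1), of v] assms(3)
    by (smt (verit) mem_Collect_eq mult_left_le)
qed

section \<open>The spectral theorem for Hermitian matrices\<close>

lemma square_mat_simps:
  fixes A B C :: "complex mat"
  shows "A \<in> carrier_mat n n \<Longrightarrow> B \<in> carrier_mat n n \<Longrightarrow> C \<in> carrier_mat n n \<Longrightarrow> A * B * C = A * (B * C)"
    "A \<in> carrier_mat n n \<Longrightarrow> B \<in> carrier_mat n n \<Longrightarrow> A * B \<in> carrier_mat n n"
  by auto

definition diagonal :: "nat \<Rightarrow> (nat \<Rightarrow> complex) \<Rightarrow> complex mat" where
  "diagonal n f = mat n n (\<lambda>(i, j). if i = j then f i else 0)"

lemma diagonal_carrier [simp, intro]: "diagonal n f \<in> carrier_mat n n"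
  by (simp add: diagonal_def)

lemma diagonal_dim [simp]: "dim_row (diagonal n f) = n" "dim_col (diagonal n f) = n"
  by (simp_all add: diagonal_def)

lemma diagonal_mult: "diagonal n f * diagonal n g = diagonal n (\<lambda>i. f i * g i)"
  by (rule eq_matI)
    (auto simp: diagonal_def scalar_prod_def if_distrib[of "\<lambda>x. x * _"] sum.delta cong: if_cong)

lemma diagonal_mult_vec:
  assumes "v \<in> carrier_vec n"
  shows "diagonal n f *\<^sub>v v = vec n (\<lambda>i. f i * v $ i)"
  using assms
  by (intro eq_vecI) (auto simp: diagonal_def scalar_prod_def if_distrib[of "\<lambda>x. x * _"] sum.delta cong: if_cong)

lemma diagonal_bound:
  assumes "\<And>i. i < n \<Longrightarrow> cmod (f i) \<le> c"
  shows "op_bound (diagonal n f) c"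
  unfolding op_bound_def
proof
  fix v :: "complex vec" assume "v \<in> carrier_vec (dim_col (diagonal n f))"
  then have v: "v \<in> carrier_vec n" by (simp add: diagonal_def)
  show "euclidean_norm_vec (diagonal n f *\<^sub>v v) \<le> c * euclidean_norm_vec v"
  proof (cases "n = 0")
    case True
    then show ?thesis using v by (simp add: euclidean_norm_vec_def diagonal_mult_vec)
  next
    case False
    then have c: "c \<ge> 0" using assms[of 0] norm_ge_zero order_trans by blast
    have "euclidean_norm_vec (diagonal n f *\<^sub>v v) = L2_set (\<lambda>i. cmod (f i) * cmod (v $ i)) {..<n}"
      unfolding euclidean_norm_vec_L2 diagonal_mult_vec[OF v] by (intro L2_set_cong) (auto simp: norm_mult)
    also have "\<dots> \<le> L2_set (\<lambda>i. c * cmod (v $ i)) {..<n}"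
      using assms by (intro L2_set_mono mult_right_mono) auto
    also have "\<dots> = c * euclidean_norm_vec v"
      using c v by (simp add: L2_set_right_distrib euclidean_norm_vec_L2)
    finally show ?thesis .
  qed
qed

text \<open>
  Functional calculus: for unitary \<open>P\<close> this is the normal matrix that has column \<open>k\<close> of \<open>P\<close>
  as an eigenvector with eigenvalue \<open>f k\<close>.
\<close>

definition spectral_mat :: "nat \<Rightarrow> complex mat \<Rightarrow> (nat \<Rightarrow> complex) \<Rightarrow> complex mat" where
  "spectral_mat n P f = P * diagonal n f * mat_adjoint P"

context
  fixes n :: nat and P :: "complex mat"
  assumes P: "P \<in> unitary_matrices n"
begin

lemma spectral_mat_carrier [simp]: "spectral_mat n P f \<in> carrier_mat n n"
  using unitary_matricesD(1)[OF P] by (auto simp: spectral_mat_def)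

lemma spectral_mat_index:
  assumes "i < n" "j < n"
  shows "spectral_mat n P f $$ (i, j) = (\<Sum>k<n. P $$ (i, k) * f k * cnj (P $$ (j, k)))"
proof -
  have "(P * diagonal n f) $$ (i, k) = P $$ (i, k) * f k" if "k < n" for k
    using unitary_matricesD(1)[OF P] assms that
    by (auto simp: diagonal_def scalar_prod_def if_distrib[of "\<lambda>x. _ * x"] sum.delta cong: if_cong)
  then show ?thesis
    using unitary_matricesD(1)[OF P] assms
    by (auto simp: spectral_mat_def scalar_prod_def lessThan_atLeast0 intro!: sum.cong)
qed

lemma spectral_mat_mult: "spectral_mat n P f * spectral_mat n P g = spectral_mat n P (\<lambda>i. f i * g i)"
proof -
  note P' = unitary_matricesD[OF P]
  let ?D = "diagonal n" and ?Q = "mat_adjoint P"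
  have c: "P \<in> carrier_mat n n" "?Q \<in> carrier_mat n n" "\<And>f. ?D f \<in> carrier_mat n n" using P' by auto
  have "P * ?D f * ?Q * (P * ?D g * ?Q) = P * (?D f * ((?Q * P) * (?D g * ?Q)))"
    using c by (simp add: square_mat_simps[where n = n] del: P'(2))
  also have "\<dots> = P * ((?D f * ?D g) * ?Q)"
    using c by (simp add: P'(2) square_mat_simps[where n = n])
  finally show ?thesis
    using c by (simp add: spectral_mat_def diagonal_mult square_mat_simps[where n = n])
qed

lemma spectral_mat_one: "spectral_mat n P (\<lambda>_. 1) = 1\<^sub>m n"
proof -
  have "diagonal n (\<lambda>_. 1) = 1\<^sub>m n" by (rule eq_matI) (auto simp: diagonal_def)
  then show ?thesis using unitary_matricesD[OF P] by (simp add: spectral_mat_def)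
qed

lemma spectral_mat_diff: "spectral_mat n P f - spectral_mat n P g = spectral_mat n P (\<lambda>i. f i - g i)"
  using spectral_mat_carrier[THEN carrier_matD(1)] spectral_mat_carrier[THEN carrier_matD(2)]
  by (intro eq_matI) (simp_all add: spectral_mat_index algebra_simps sum_subtractf)

lemma spectral_mat_adjoint: "mat_adjoint (spectral_mat n P f) = spectral_mat n P (\<lambda>i. cnj (f i))"
  using spectral_mat_carrier[THEN carrier_matD(1)] spectral_mat_carrier[THEN carrier_matD(2)]
  by (intro eq_matI) (simp_all add: spectral_mat_index mult_ac)

lemma spectral_mat_bound:
  assumes "\<And>i. i < n \<Longrightarrow> cmod (f i) \<le> c" "0 \<le> c"
  shows "op_bound (spectral_mat n P f) c"
proof -
  note P' = unitary_matricesD(1)[OF P]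
  have "op_bound (P * diagonal n f) (1 * c)"
    by (rule op_bound_mult[OF op_bound_unitary[OF P] diagonal_bound P']) (use assms in auto)
  from op_bound_mult[OF this op_bound_unitary[OF unitary_matrices_adjoint[OF P]], of n n n]
  show ?thesis using P' assms(2) by (auto simp: spectral_mat_def)
qed

text \<open>The converse holds because the columns of \<open>P\<close> are unit eigenvectors for the values of \<open>f\<close>.\<close>

lemma spectral_mat_boundD:
  assumes "op_bound (spectral_mat n P f) c" "i < n"
  shows "cmod (f i) \<le> c"
proof -
  note P' = unitary_matricesD[OF P]
  let ?e = "unit_vec n i :: complex vec"
  have e: "?e \<in> carrier_vec n" by simp
  have "mat_adjoint P *\<^sub>v (P *\<^sub>v ?e) = ?e"
    using P' e by (metis assoc_mult_mat_vec mat_adjoint_carrier one_mult_mat_vec)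
  moreover have "spectral_mat n P f *\<^sub>v (P *\<^sub>v ?e) = P *\<^sub>v (diagonal n f *\<^sub>v (mat_adjoint P *\<^sub>v (P *\<^sub>v ?e)))"
    unfolding spectral_mat_def
    using P'(1) mult_mat_vec_carrier[OF P'(1) e] mult_mat_vec_carrier[OF mat_adjoint_carrier[OF P'(1)]]
    by (simp add: assoc_mult_mat_vec[of _ n n _ n])
  moreover have "diagonal n f *\<^sub>v ?e = f i \<cdot>\<^sub>v ?e"
    unfolding diagonal_mult_vec[OF e] by (rule eq_vecI) (auto simp: unit_vec_def)
  ultimately have "spectral_mat n P f *\<^sub>v (P *\<^sub>v ?e) = P *\<^sub>v (f i \<cdot>\<^sub>v ?e)" by simp
  then have "euclidean_norm_vec (P *\<^sub>v (f i \<cdot>\<^sub>v ?e)) \<le> c * euclidean_norm_vec (P *\<^sub>v ?e)"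
    using op_boundD[OF assms(1) spectral_mat_carrier mult_mat_vec_carrier[OF P'(1) e]] by simp
  then show ?thesis
    using assms(2) by (simp add: euclidean_norm_vec_isometry[OF P'(1,2)] euclidean_norm_vec_smult euclidean_norm_vec_unit)
qed

end

text \<open>
  Complete \<open>v\<close> to a basis, apply Gram--Schmidt, and normalize the resulting columns.
\<close>

lemma unitary_with_first_column:
  fixes v :: "complex vec"
  assumes v: "v \<in> carrier_vec n" and v0: "v \<noteq> 0\<^sub>v n" and n: "n \<noteq> 0"
  shows "\<exists>U\<in>unitary_matrices n. \<exists>c. col U 0 = c \<cdot>\<^sub>v v"
proof -
  define b where "b = basis_completion v"
  define ws where "ws = gram_schmidt n b"
  interpret cof_vec_space n "TYPE(complex)" .
  from basis_completion[OF v v0, folded b_def]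
  have dist_b: "distinct b" and indep: "\<not> lin_dep (set b)" and b: "set b \<subseteq> carrier_vec n"
    and hdb: "hd b = v" and len_b: "length b = n" by auto
  from hdb len_b n obtain vs where bv: "b = v # vs" by (cases b) auto
  from gram_schmidt_result[OF b dist_b indep refl, folded ws_def]
  have ws: "set ws \<subseteq> carrier_vec n" "corthogonal ws" "length ws = n"
    by (auto simp: len_b)
  have hdws: "ws ! 0 = v"
    using gram_schmidt_hd[OF v, of vs, folded bv] n ws(3) unfolding ws_def[symmetric]
    by (metis hd_conv_nth length_0_conv)
  define r where "r j = euclidean_norm_vec (ws ! j)" for j
  have wsj: "ws ! j \<in> carrier_vec n" if "j < n" for j using ws that by auto
  have r: "r j \<noteq> 0" if "j < n" for j
    using corthogonalD[OF ws(2), of j j] ws(3) that by (auto simp: r_def cscalar_prod_self)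
  define U where "U = mat n n (\<lambda>(i, j). ws ! j $ i / complex_of_real (r j))"
  have "mat_adjoint U * U = 1\<^sub>m n"
  proof (rule eq_matI)
    fix i j assume "i < dim_row (1\<^sub>m n :: complex mat)" "j < dim_col (1\<^sub>m n :: complex mat)"
    then have ij: "i < n" "j < n" by auto
    have "(mat_adjoint U * U) $$ (i, j) = (ws ! j \<bullet>c ws ! i) / (complex_of_real (r i) * complex_of_real (r j))"
      using ij wsj[OF ij(1)] wsj[OF ij(2)]
      by (auto simp: U_def scalar_prod_def sum_divide_distrib mult_ac intro!: sum.cong)
    also have "\<dots> = 1\<^sub>m n $$ (i, j)"
      using corthogonalD[OF ws(2), of j i] ij ws(3) r
      by (auto simp: cscalar_prod_self r_def power2_eq_square)
    finally show "(mat_adjoint U * U) $$ (i, j) = 1\<^sub>m n $$ (i, j)" .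
  qed (auto simp: U_def)
  then have "U \<in> unitary_matrices n" by (intro unitary_matricesI) (auto simp: U_def)
  moreover have "col U 0 = (1 / complex_of_real (r 0)) \<cdot>\<^sub>v v"
    using n v by (intro eq_vecI) (auto simp: U_def hdws)
  ultimately show ?thesis by blast
qed

lemma mat_adjoint_four_block:
  fixes A :: "complex mat"
  assumes "A \<in> carrier_mat a b" "B \<in> carrier_mat a d" "C \<in> carrier_mat c b" "D \<in> carrier_mat c d"
  shows "mat_adjoint (four_block_mat A B C D) =
    four_block_mat (mat_adjoint A) (mat_adjoint C) (mat_adjoint B) (mat_adjoint D)"
  using assms by (intro eq_matI) auto

lemma mat_adjoint_zero [simp]: "mat_adjoint (0\<^sub>m m n) = (0\<^sub>m n m :: complex mat)"
  by (rule eq_matI) auto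

lemma four_block_diag_mult:
  fixes A A' :: "complex mat"
  assumes "A \<in> carrier_mat a a" "D \<in> carrier_mat d d" "A' \<in> carrier_mat a a" "D' \<in> carrier_mat d d"
  shows "four_block_mat A (0\<^sub>m a d) (0\<^sub>m d a) D * four_block_mat A' (0\<^sub>m a d) (0\<^sub>m d a) D' =
    four_block_mat (A * A') (0\<^sub>m a d) (0\<^sub>m d a) (D * D')"
  using assms by (subst mult_four_block_mat[of _ a a _ d _ d _ _ a _ d]) auto

text \<open>
  Induction on the dimension: a unitary \<open>W\<close> whose first column is an eigenvector makes
  the first column of \<open>W\<^sup>* A W\<close> a multiple of the first unit vector; being Hermitian,
  this matrix splits off a real \<open>1 \<times> 1\<close> block.
\<close>

theorem hermitian_spectral:
  fixes A :: "complex mat"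
  assumes "A \<in> carrier_mat n n" "mat_adjoint A = A"
  shows "\<exists>U\<in>unitary_matrices n. \<exists>\<nu> :: nat \<Rightarrow> real. A = spectral_mat n U (\<lambda>i. complex_of_real (\<nu> i))"
  using assms
proof (induction n arbitrary: A)
  case 0
  have "A = spectral_mat 0 (1\<^sub>m 0) (\<lambda>i. complex_of_real 0)"
    using 0 by (intro eq_matI) (auto simp: spectral_mat_def)
  then show ?case using unitary_matrices_one by (intro bexI[of _ "1\<^sub>m 0"] exI[of _ "\<lambda>_. 0"]) auto
next
  case (Suc k A)
  let ?n = "Suc k"
  note A = Suc.prems(1)
  from spectrum_non_empty[OF A] obtain e v where "eigenvector A v e"
    by (auto simp: spectrum_def eigenvalue_def)
  then have v: "v \<in> carrier_vec ?n" "v \<noteq> 0\<^sub>v ?n" "A *\<^sub>v v = e \<cdot>\<^sub>v v"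
    using A by (auto simp: eigenvector_def)
  obtain W c where W: "W \<in> unitary_matrices ?n" and Wc: "col W 0 = c \<cdot>\<^sub>v v"
    using unitary_with_first_column[OF v(1,2)] by auto
  note W' = unitary_matricesD[OF W]
  define B where "B = mat_adjoint W * (A * W)"
  have B: "B \<in> carrier_mat ?n ?n" using W' A by (auto simp: B_def)
  have BW: "W * B * mat_adjoint W = A"
  proof -
    have "W * B * mat_adjoint W = (W * mat_adjoint W) * (A * (W * mat_adjoint W))"
      unfolding B_def using W'(1) A by (simp add: square_mat_simps[where n = ?n] del: W')
    then show ?thesis using W' A by simp
  qed
  have Badj: "mat_adjoint B = B"
    unfolding B_def using W'(1) A Suc.prems(2)
    by (simp add: mat_adjoint_mult[of _ ?n ?n _ ?n] square_mat_simps[where n = ?n])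
  have Bsym: "B $$ (i, j) = cnj (B $$ (j, i))" if "i < ?n" "j < ?n" for i j
    using B that mat_adjoint_index[of i B j] unfolding Badj by auto
  have col_carrier: "col W 0 \<in> carrier_vec ?n" using W'(1) by (intro carrier_vecI) simp
  have "col B 0 = mat_adjoint W *\<^sub>v col (A * W) 0"
    unfolding B_def by (rule col_mult2[OF mat_adjoint_carrier[OF W'(1)] mult_carrier_mat[OF A W'(1)]]) simp
  also have "col (A * W) 0 = A *\<^sub>v col W 0" by (rule col_mult2[OF A W'(1)]) simp
  also have "A *\<^sub>v col W 0 = e \<cdot>\<^sub>v col W 0"
    unfolding Wc using A v by (simp add: mult_mat_vec smult_smult_assoc mult.commute)
  also have "mat_adjoint W *\<^sub>v (e \<cdot>\<^sub>v col W 0) = e \<cdot>\<^sub>v col (mat_adjoint W * W) 0"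
    using mult_mat_vec[OF mat_adjoint_carrier[OF W'(1)] col_carrier, of e] W'(1)
      col_mult2[OF mat_adjoint_carrier[OF W'(1)] W'(1), of 0] by simp
  finally have colB: "col B 0 = e \<cdot>\<^sub>v unit_vec ?n 0" using W' by simp
  have B0: "B $$ (i, 0) = (if i = 0 then e else 0)" if "i < ?n" for i
    using arg_cong[OF colB, of "\<lambda>v. v $ i"] that B by (auto simp: unit_vec_def)
  have e: "e = complex_of_real (Re e)"
    using Bsym[of 0 0] B0[of 0] by (simp add: complex_eq_iff)
  have B0': "B $$ (0, j) = (if j = 0 then e else 0)" if "j < ?n" for j
  proof (cases "j = 0")
    case False
    have "B $$ (0, j) = cnj (B $$ (j, 0))" using that by (intro Bsym) auto
    then show ?thesis using B0[OF that] False by simp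
  qed (simp add: B0)
  define C where "C = mat k k (\<lambda>(i, j). B $$ (Suc i, Suc j))"
  have Bblock: "B = four_block_mat (e \<cdot>\<^sub>m 1\<^sub>m 1) (0\<^sub>m 1 k) (0\<^sub>m k 1) C"
    using B B0 B0' by (intro eq_matI) (auto simp: C_def)
  have Cadj: "mat_adjoint C = C"
  proof (rule eq_matI)
    fix i j assume "i < dim_row C" "j < dim_col C"
    then show "mat_adjoint C $$ (i, j) = C $$ (i, j)"
      using Bsym[of "Suc i" "Suc j"] by (simp add: C_def)
  qed (auto simp: C_def)
  from Suc.IH[OF _ Cadj] obtain P \<nu> where P: "P \<in> unitary_matrices k"
    and C: "C = spectral_mat k P (\<lambda>i. complex_of_real (\<nu> i))" by (auto simp: C_def)
  note P' = unitary_matricesD[OF P]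
  define Q where "Q = four_block_mat (1\<^sub>m 1) (0\<^sub>m 1 k) (0\<^sub>m k 1) P"
  define \<mu> where "\<mu> i = (if i = 0 then Re e else \<nu> (i - 1))" for i
  have Qc: "Q \<in> carrier_mat ?n ?n" using P'(1) by (auto simp: Q_def)
  have Qadj: "mat_adjoint Q = four_block_mat (1\<^sub>m 1) (0\<^sub>m 1 k) (0\<^sub>m k 1) (mat_adjoint P)"
    using P'(1) by (simp add: Q_def mat_adjoint_four_block[of _ 1 1 _ k _ k])
  have "mat_adjoint Q * Q = four_block_mat (1\<^sub>m 1 * 1\<^sub>m 1) (0\<^sub>m 1 k) (0\<^sub>m k 1) (mat_adjoint P * P)"
    unfolding Qadj unfolding Q_def using P'(1) by (intro four_block_diag_mult) auto
  also have "\<dots> = 1\<^sub>m (1 + k)"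
    unfolding P'(2) left_mult_one_mat[OF one_carrier_mat] by (rule four_block_one_mat)
  finally have Q: "Q \<in> unitary_matrices ?n"
    using Qc by (intro unitary_matricesI) simp_all
  have D: "diagonal ?n (\<lambda>i. complex_of_real (\<mu> i)) =
      four_block_mat (e \<cdot>\<^sub>m 1\<^sub>m 1) (0\<^sub>m 1 k) (0\<^sub>m k 1) (diagonal k (\<lambda>i. complex_of_real (\<nu> i)))"
    using e by (intro eq_matI) (auto simp: diagonal_def \<mu>_def)
  have "spectral_mat ?n Q (\<lambda>i. complex_of_real (\<mu> i)) = B"
    unfolding spectral_mat_def D Qadj Bblock C
    using P'(1) by (simp add: Q_def four_block_diag_mult spectral_mat_def)
  then have "A = W * (Q * diagonal ?n (\<lambda>i. complex_of_real (\<mu> i)) * mat_adjoint Q) * mat_adjoint W"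
    using BW by (simp add: spectral_mat_def)
  also have "\<dots> = spectral_mat ?n (W * Q) (\<lambda>i. complex_of_real (\<mu> i))"
    using W'(1) Qc
    by (simp add: spectral_mat_def mat_adjoint_mult[of _ ?n ?n _ ?n] square_mat_simps[where n = ?n])
  finally show ?case using unitary_matrices_mult[OF W Q] by blast
qed

section \<open>Rounding almost-projections and almost-unitary matrices\<close>

text \<open>
  The rows of \<open>V\<close> are the eigenvectors whose eigenvalue \<open>\<nu>\<close> exceeds \<open>1/2\<close>. The bound
  comes from \<open>|\<nu> - 1| \<le> 2 |\<nu>\<^sup>2 - \<nu>|\<close> in that case and \<open>|\<nu>| \<le> 2 |\<nu>\<^sup>2 - \<nu>|\<close> otherwise.
  Thus \<open>V\<^sup>* V\<close> is a projection near \<open>H\<close>, and \<open>V\<close> identifies its range with \<open>\<complex>\<^sup>d\<close>.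
\<close>

lemma almost_projection_range:
  fixes H :: "complex mat"
  assumes "H \<in> carrier_mat n n" "mat_adjoint H = H"
  shows "\<exists>d V. d \<le> n \<and> V \<in> carrier_mat d n \<and> V * mat_adjoint V = 1\<^sub>m d \<and>
    (\<forall>c\<ge>0. op_bound (H * H - H) c \<longrightarrow> op_bound (mat_adjoint V * V - H) (2 * c))"
proof -
  obtain P \<nu> where P: "P \<in> unitary_matrices n" and H: "H = spectral_mat n P (\<lambda>i. complex_of_real (\<nu> i))"
    using hermitian_spectral[OF assms] by blast
  note P' = unitary_matricesD[OF P]
  \<comment> \<open>the spectral projection for \<open>(1/2, \<infinity>)\<close>, with \<open>f\<close> enumerating the chosen eigenvectors\<close>
  define I where "I = {i. i < n \<and> \<nu> i > 1/2}"
  define d where "d = card I"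
  have finI: "finite I" by (simp add: I_def)
  have "card I \<le> card {..<n}" by (rule card_mono) (auto simp: I_def)
  then have dn: "d \<le> n" by (simp add: d_def)
  obtain f where f: "bij_betw f {..<d} I"
    using ex_bij_betw_nat_finite[OF finI] by (auto simp: d_def lessThan_atLeast0)
  have fI: "f i \<in> I" "f i < n" if "i < d" for i
    using bij_betwE[OF f] that by (auto simp: I_def)
  define V where "V = mat d n (\<lambda>(i, j). cnj (P $$ (j, f i)))"
  have V: "V \<in> carrier_mat d n" by (simp add: V_def)
  have PP: "(\<Sum>j<n. cnj (P $$ (j, k)) * P $$ (j, l)) = (if k = l then 1 else 0)" if "k < n" "l < n" for k l
    using arg_cong[OF P'(2), of "\<lambda>M. M $$ (k, l)"] P'(1) that
    by (simp add: scalar_prod_def lessThan_atLeast0)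
  have "V * mat_adjoint V = 1\<^sub>m d"
  proof (rule eq_matI)
    fix i j assume "i < dim_row (1\<^sub>m d :: complex mat)" "j < dim_col (1\<^sub>m d :: complex mat)"
    then have ij: "i < d" "j < d" by auto
    have "(V * mat_adjoint V) $$ (i, j) = (\<Sum>l<n. cnj (P $$ (l, f i)) * P $$ (l, f j))"
      using ij by (simp add: V_def scalar_prod_def lessThan_atLeast0)
    also have "\<dots> = (if i = j then 1 else 0)"
      using PP[OF fI(2)[OF ij(1)] fI(2)[OF ij(2)]] bij_betw_imp_inj_on[OF f] ij
      by (auto dest: inj_onD)
    finally show "(V * mat_adjoint V) $$ (i, j) = 1\<^sub>m d $$ (i, j)" using ij by simp
  qed (auto simp: V_def)
  moreover have VV: "mat_adjoint V * V = spectral_mat n P (\<lambda>i. if i \<in> I then 1 else 0)"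
  proof (rule eq_matI)
    let ?S = "spectral_mat n P (\<lambda>i. if i \<in> I then 1 else 0)"
    have S: "?S \<in> carrier_mat n n" by (rule spectral_mat_carrier[OF P])
    fix i j assume "i < dim_row ?S" "j < dim_col ?S"
    then have ij: "i < n" "j < n" using S by auto
    have "(mat_adjoint V * V) $$ (i, j) = (\<Sum>l<d. P $$ (i, f l) * cnj (P $$ (j, f l)))"
      using ij by (simp add: V_def scalar_prod_def lessThan_atLeast0)
    also have "\<dots> = (\<Sum>l\<in>I. P $$ (i, l) * cnj (P $$ (j, l)))"
      by (rule sum.reindex_bij_betw[OF f])
    also have "\<dots> = (\<Sum>l<n. P $$ (i, l) * (if l \<in> I then 1 else 0) * cnj (P $$ (j, l)))"
      by (rule sum.mono_neutral_cong_left) (auto simp: I_def)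
    finally show "(mat_adjoint V * V) $$ (i, j) = ?S $$ (i, j)"
      using ij by (simp add: spectral_mat_index[OF P])
  qed (use V spectral_mat_carrier[OF P, of "\<lambda>i. if i \<in> I then 1 else 0"] in auto)
  moreover have "op_bound (mat_adjoint V * V - H) (2 * c)" if c: "0 \<le> c" "op_bound (H * H - H) c" for c
    unfolding VV H spectral_mat_diff[OF P]
  proof (rule spectral_mat_bound[OF P])
    fix i assume i: "i < n"
    have "cmod (complex_of_real (\<nu> i) * complex_of_real (\<nu> i) - complex_of_real (\<nu> i)) \<le> c"
      using spectral_mat_boundD[OF P _ i] c(2) unfolding H spectral_mat_mult[OF P] spectral_mat_diff[OF P] by blast
    then have "\<bar>\<nu> i * \<nu> i - \<nu> i\<bar> \<le> c" by (metis norm_of_real of_real_diff of_real_mult)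
    then have *: "\<bar>\<nu> i\<bar> * \<bar>\<nu> i - 1\<bar> \<le> c" by (simp add: abs_mult[symmetric] algebra_simps)
    show "cmod ((if i \<in> I then 1 else 0) - complex_of_real (\<nu> i)) \<le> 2 * c"
    proof (cases "i \<in> I")
      case True
      then have "1/2 * \<bar>\<nu> i - 1\<bar> \<le> \<bar>\<nu> i\<bar> * \<bar>\<nu> i - 1\<bar>" by (intro mult_right_mono) (auto simp: I_def)
      moreover have "cmod (1 - complex_of_real (\<nu> i)) = \<bar>\<nu> i - 1\<bar>"
        by (metis norm_of_real of_real_1 of_real_diff abs_minus_commute)
      ultimately show ?thesis using True * by simp
    next
      case False
      then have "\<bar>\<nu> i\<bar> * (1/2) \<le> \<bar>\<nu> i\<bar> * \<bar>\<nu> i - 1\<bar>"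
        using i by (intro mult_left_mono) (auto simp: I_def)
      then show ?thesis using False * by simp
    qed
  qed (use c in auto)
  ultimately show ?thesis using dn V by blast
qed

text \<open>
  Let \<open>u\<close> be the unitary part of the polar decomposition \<open>w = u s\<close>, where \<open>s\<close> is the positive
  square root of \<open>w\<^sup>* w\<close>. Then \<open>u - w = u (1 - s)\<close>, and \<open>|1 - sqrt \<mu>| \<le> |1 - \<mu>|\<close> for every
  eigenvalue \<open>\<mu> > 0\<close> of \<open>w\<^sup>* w\<close>. When \<open>w\<close> is singular, no bound below \<open>1\<close> holds for
  \<open>w\<^sup>* w - 1\<close>, and the identity serves as \<open>u\<close>. One \<open>u\<close> works for all \<open>c\<close>, so that it
  can be chosen before the limit is taken.
\<close>

lemma almost_unitary_near_unitary:
  fixes w :: "complex mat"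
  assumes w: "w \<in> carrier_mat n n"
  shows "\<exists>u\<in>unitary_matrices n. \<forall>c. 0 \<le> c \<longrightarrow> c < 1 \<longrightarrow>
    op_bound (mat_adjoint w * w - 1\<^sub>m n) c \<longrightarrow> op_bound (u - w) c"
proof -
  let ?K = "mat_adjoint w * w"
  have K: "?K \<in> carrier_mat n n" "mat_adjoint ?K = ?K"
    using w by (auto simp: mat_adjoint_mult[of _ n n _ n])
  obtain P \<mu> where P: "P \<in> unitary_matrices n" and KP: "?K = spectral_mat n P (\<lambda>i. complex_of_real (\<mu> i))"
    using hermitian_spectral[OF K] by blast
  let ?S = "spectral_mat n P"
  note S = spectral_mat_carrier[OF P] and Smult = spectral_mat_mult[OF P]
  have close: "\<bar>\<mu> i - 1\<bar> \<le> c" if "op_bound (?K - 1\<^sub>m n) c" "i < n" for i c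
  proof -
    have "cmod (complex_of_real (\<mu> i) - 1) \<le> c"
      using spectral_mat_boundD[OF P _ that(2)] that(1)
      unfolding KP spectral_mat_one[OF P, symmetric] spectral_mat_diff[OF P] by blast
    then show ?thesis by (metis norm_of_real of_real_1 of_real_diff)
  qed
  show ?thesis
  proof (cases "\<forall>i<n. \<mu> i > 0")
    case False
    then have "\<not> (c < 1 \<and> op_bound (?K - 1\<^sub>m n) c)" for c using close[of c] by force
    then show ?thesis using unitary_matrices_one by blast
  next
    case pos: True
    define r where "r = ?S (\<lambda>i. complex_of_real (1 / sqrt (\<mu> i)))"
    have r: "r \<in> carrier_mat n n" "mat_adjoint r = r" using S by (simp_all add: r_def spectral_mat_adjoint[OF P])
    let ?s = "?S (\<lambda>i. complex_of_real (sqrt (\<mu> i)))"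
    have Scong: "?S f = ?S g" if "\<And>i. i < n \<Longrightarrow> f i = g i" for f g
    proof -
      have "diagonal n f = diagonal n g" using that by (intro eq_matI) (auto simp: diagonal_def)
      then show ?thesis by (simp add: spectral_mat_def)
    qed
    define u where "u = w * r"
    have u: "u \<in> carrier_mat n n" using w r by (auto simp: u_def)
    have "mat_adjoint u * u = r * (?K * r)"
      unfolding u_def using w r
      by (simp add: mat_adjoint_mult[of _ n n _ n] square_mat_simps[where n = n])
    also have "\<dots> = ?S (\<lambda>_. 1)"
      unfolding KP r_def Smult
    proof (rule Scong)
      fix i assume "i < n"
      then have "\<mu> i > 0" using pos by blast
      then show "complex_of_real (1 / sqrt (\<mu> i)) * (complex_of_real (\<mu> i) * complex_of_real (1 / sqrt (\<mu> i))) = 1"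
        by (simp add: real_sqrt_mult_self field_simps flip: of_real_mult of_real_divide)
    qed
    finally have uu: "u \<in> unitary_matrices n"
      using u by (intro unitary_matricesI) (simp_all add: spectral_mat_one[OF P])
    have "r * ?s = 1\<^sub>m n"
      unfolding r_def Smult spectral_mat_one[OF P, symmetric]
      using pos by (intro Scong) (auto simp flip: of_real_mult)
    then have us: "u * ?s = w"
      using w S r by (simp add: u_def square_mat_simps[where n = n])
    have "op_bound (u - w) c" if c: "0 \<le> c" "op_bound (?K - 1\<^sub>m n) c" for c
    proof -
      have "u - w = u * (1\<^sub>m n - ?s)"
        using u S us by (simp add: mult_minus_distrib_mat[of _ n n _ n])
      moreover have "op_bound (1\<^sub>m n - ?s) c"
        unfolding spectral_mat_one[OF P, symmetric] spectral_mat_diff[OF P]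
      proof (rule spectral_mat_bound[OF P])
        fix i assume i: "i < n"
        have \<mu>: "\<mu> i > 0" using pos i by blast
        then have "1 - \<mu> i = (1 - sqrt (\<mu> i)) * (1 + sqrt (\<mu> i))" by (simp add: algebra_simps)
        then have "\<bar>1 - \<mu> i\<bar> = \<bar>1 - sqrt (\<mu> i)\<bar> * (1 + sqrt (\<mu> i))"
          using \<mu> by (simp add: abs_mult)
        also have "\<dots> \<ge> \<bar>1 - sqrt (\<mu> i)\<bar> * 1"
          using \<mu> by (intro mult_left_mono) auto
        finally have "\<bar>1 - sqrt (\<mu> i)\<bar> \<le> c" using close[OF c(2) i] by simp
        then show "cmod (1 - complex_of_real (sqrt (\<mu> i))) \<le> c"
          by (metis norm_of_real of_real_1 of_real_diff)
      qed (use c in auto)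
      ultimately show ?thesis
        using op_bound_mult[OF op_bound_unitary[OF uu] _ u minus_carrier_mat[OF S], of "1\<^sub>m n" "\<lambda>i. complex_of_real (sqrt (\<mu> i))" c] by simp
    qed
    then show ?thesis using uu by blast
  qed
qed

section \<open>Asymptotic equality of bounded matrix sequences\<close>

definition bounded_seq :: "(nat \<Rightarrow> nat) \<Rightarrow> (nat \<Rightarrow> nat) \<Rightarrow> (nat \<Rightarrow> complex mat) \<Rightarrow> bool" where
  "bounded_seq r c X \<longleftrightarrow> (\<forall>n. X n \<in> carrier_mat (r n) (c n)) \<and> (\<exists>C\<ge>0. \<forall>n. op_bound (X n) C)"

text \<open>
  Equality in the quotient of bounded sequences by the sequences that tend to \<open>0\<close> in operator
  norm. Boundedness is part of the relation, so that it is a congruence without side conditions.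
\<close>

definition asymp_eq ::
    "(nat \<Rightarrow> nat) \<Rightarrow> (nat \<Rightarrow> nat) \<Rightarrow> (nat \<Rightarrow> complex mat) \<Rightarrow> (nat \<Rightarrow> complex mat) \<Rightarrow> bool" where
  "asymp_eq r c X Y \<longleftrightarrow> bounded_seq r c X \<and> bounded_seq r c Y \<and>
     (\<forall>e>0. \<forall>\<^sub>F n in sequentially. op_bound (X n - Y n) e)"

lemma bounded_seqD: "bounded_seq r c X \<Longrightarrow> X n \<in> carrier_mat (r n) (c n)"
  by (simp add: bounded_seq_def)

lemma bounded_seqI:
  "(\<And>n. X n \<in> carrier_mat (r n) (c n)) \<Longrightarrow> 0 \<le> C \<Longrightarrow> (\<And>n. op_bound (X n) C) \<Longrightarrow> bounded_seq r c X"
  by (auto simp: bounded_seq_def)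

lemma bounded_seq_mult:
  assumes "bounded_seq r m X" "bounded_seq m c Y"
  shows "bounded_seq r c (\<lambda>n. X n * Y n)"
proof -
  from assms obtain C D where CD: "0 \<le> C" "0 \<le> D" "\<And>n. op_bound (X n) C" "\<And>n. op_bound (Y n) D"
    by (auto simp: bounded_seq_def)
  note c = bounded_seqD[OF assms(1)] bounded_seqD[OF assms(2)]
  show ?thesis
    by (rule bounded_seqI[OF mult_carrier_mat[OF c] mult_nonneg_nonneg[OF CD(1,2)] op_bound_mult[OF CD(3,4) c CD(1)]])
qed

lemma bounded_seq_add:
  assumes "bounded_seq r c X" "bounded_seq r c Y"
  shows "bounded_seq r c (\<lambda>n. X n + Y n)"
proof -
  from assms obtain C D where CD: "0 \<le> C" "0 \<le> D" "\<And>n. op_bound (X n) C" "\<And>n. op_bound (Y n) D"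
    by (auto simp: bounded_seq_def)
  note c = bounded_seqD[OF assms(1)] bounded_seqD[OF assms(2)]
  show ?thesis
    by (rule bounded_seqI[OF add_carrier_mat[OF c(2)] add_nonneg_nonneg[OF CD(1,2)] op_bound_add[OF CD(3,4) c]])
qed

lemma bounded_seq_smult:
  assumes "bounded_seq r c X"
  shows "bounded_seq r c (\<lambda>n. k \<cdot>\<^sub>m X n)"
proof -
  from assms obtain C where "0 \<le> C" "\<And>n. op_bound (X n) C"
    by (auto simp: bounded_seq_def)
  then show ?thesis
    using assms by (intro bounded_seqI[of _ _ _ "cmod k * C"]) (auto simp: bounded_seq_def intro!: op_bound_smult)
qed

lemma minus_mat_eq_add_smult:
  fixes A B :: "complex mat"
  assumes "A \<in> carrier_mat m n" "B \<in> carrier_mat m n"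
  shows "A - B = A + (-1) \<cdot>\<^sub>m B"
  using assms by (intro eq_matI) auto

lemma bounded_seq_diff:
  assumes "bounded_seq r c X" "bounded_seq r c Y"
  shows "bounded_seq r c (\<lambda>n. X n - Y n)"
  using bounded_seq_add[OF assms(1) bounded_seq_smult[OF assms(2), of "-1"]]
  by (simp add: minus_mat_eq_add_smult[OF bounded_seqD[OF assms(1)] bounded_seqD[OF assms(2)]])

lemma bounded_seq_adjoint:
  assumes "bounded_seq r c X"
  shows "bounded_seq c r (\<lambda>n. mat_adjoint (X n))"
proof -
  from assms obtain C where "0 \<le> C" "\<And>n. op_bound (X n) C"
    by (auto simp: bounded_seq_def)
  then show ?thesis
    using assms by (intro bounded_seqI[of _ _ _ C]) (auto simp: bounded_seq_def intro!: op_bound_adjoint)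
qed

lemma bounded_seq_zero: "bounded_seq r c (\<lambda>n. 0\<^sub>m (r n) (c n))"
  by (rule bounded_seqI[of _ _ _ 0]) auto

lemma bounded_seq_unitary: "(\<And>n. X n \<in> unitary_matrices (d n)) \<Longrightarrow> bounded_seq d d X"
  by (rule bounded_seqI[of _ _ _ 1]) (auto intro: unitary_matricesD(1) op_bound_unitary)

lemma bounded_seq_one: "bounded_seq d d (\<lambda>n. 1\<^sub>m (d n))"
  by (rule bounded_seq_unitary) (rule unitary_matrices_one)

lemma asymp_eqD: "asymp_eq r c X Y \<Longrightarrow> 0 < e \<Longrightarrow> \<forall>\<^sub>F n in sequentially. op_bound (X n - Y n) e"
  by (simp add: asymp_eq_def)

lemma asymp_eq_bounded: "asymp_eq r c X Y \<Longrightarrow> bounded_seq r c X" "asymp_eq r c X Y \<Longrightarrow> bounded_seq r c Y"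
  by (simp_all add: asymp_eq_def)

lemma asymp_eq_refl: "bounded_seq r c X \<Longrightarrow> asymp_eq r c X X"
  by (simp add: asymp_eq_def minus_r_inv_mat[OF bounded_seqD])

lemma asymp_eq_sym: "asymp_eq r c X Y \<Longrightarrow> asymp_eq r c Y X"
  unfolding asymp_eq_def
  by (auto elim!: eventually_mono dest: op_bound_minus_commute[OF _ bounded_seqD bounded_seqD])

lemma asymp_eq_add:
  assumes "asymp_eq r c X X'" "asymp_eq r c Y Y'"
  shows "asymp_eq r c (\<lambda>n. X n + Y n) (\<lambda>n. X' n + Y' n)"
  unfolding asymp_eq_def
proof (intro conjI allI impI)
  note b = assms[THEN asymp_eq_bounded(1)] assms[THEN asymp_eq_bounded(2)]
  fix e :: real assume "e > 0"
  then have "\<forall>\<^sub>F n in sequentially. op_bound (X n - X' n) (e / 2)" "\<forall>\<^sub>F n in sequentially. op_bound (Y n - Y' n) (e / 2)"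
    using asymp_eqD[OF assms(1)] asymp_eqD[OF assms(2)] by simp_all
  then show "\<forall>\<^sub>F n in sequentially. op_bound (X n + Y n - (X' n + Y' n)) e"
  proof eventually_elim
    case (elim n)
    note c = b[THEN bounded_seqD, of n]
    have "X n + Y n - (X' n + Y' n) = (X n - X' n) + (Y n - Y' n)"
      using c by (intro eq_matI) auto
    then show ?case
      using op_bound_add[OF elim, of "r n" "c n"] c by (simp add: minus_carrier_mat)
  qed
qed (use assms in \<open>auto intro!: bounded_seq_add dest: asymp_eq_bounded\<close>)

lemma asymp_eq_trans [trans]:
  assumes "asymp_eq r c X Y" "asymp_eq r c Y Z"
  shows "asymp_eq r c X Z"
  unfolding asymp_eq_def
proof (intro conjI allI impI)
  note b = assms[THEN asymp_eq_bounded(1)] assms[THEN asymp_eq_bounded(2)]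
  fix e :: real assume "e > 0"
  then have "\<forall>\<^sub>F n in sequentially. op_bound (X n - Y n) (e / 2)" "\<forall>\<^sub>F n in sequentially. op_bound (Y n - Z n) (e / 2)"
    using asymp_eqD[OF assms(1)] asymp_eqD[OF assms(2)] by simp_all
  then show "\<forall>\<^sub>F n in sequentially. op_bound (X n - Z n) e"
  proof eventually_elim
    case (elim n)
    note c = b[THEN bounded_seqD, of n]
    have "X n - Z n = (X n - Y n) + (Y n - Z n)"
      using c by (intro eq_matI) auto
    then show ?case
      using op_bound_add[OF elim, of "r n" "c n"] c by (simp add: minus_carrier_mat)
  qed
qed (use assms in \<open>auto dest: asymp_eq_bounded\<close>)

lemma asymp_eq_smult:
  assumes "asymp_eq r c X Y"
  shows "asymp_eq r c (\<lambda>n. k \<cdot>\<^sub>m X n) (\<lambda>n. k \<cdot>\<^sub>m Y n)"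
  unfolding asymp_eq_def
proof (intro conjI allI impI)
  note b = assms[THEN asymp_eq_bounded(1)] assms[THEN asymp_eq_bounded(2)]
  fix e :: real assume e: "e > 0"
  then have "\<forall>\<^sub>F n in sequentially. op_bound (X n - Y n) (e / (cmod k + 1))"
    by (intro asymp_eqD[OF assms] divide_pos_pos add_nonneg_pos e) auto
  then show "\<forall>\<^sub>F n in sequentially. op_bound (k \<cdot>\<^sub>m X n - k \<cdot>\<^sub>m Y n) e"
  proof eventually_elim
    case (elim n)
    have "k \<cdot>\<^sub>m X n - k \<cdot>\<^sub>m Y n = k \<cdot>\<^sub>m (X n - Y n)"
      using b[THEN bounded_seqD, of n] by (intro eq_matI) (auto simp: algebra_simps)
    moreover have "cmod k * (e / (cmod k + 1)) \<le> e"
    proof -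
      have "cmod k + 1 > 0" by (intro add_nonneg_pos) auto
      then show ?thesis using e by (simp add: field_simps)
    qed
    ultimately show ?case
      using op_bound_mono[OF op_bound_smult[OF elim]] by simp
  qed
qed (use assms in \<open>auto intro!: bounded_seq_smult dest: asymp_eq_bounded\<close>)

lemma asymp_eq_diff:
  assumes "asymp_eq r c X X'" "asymp_eq r c Y Y'"
  shows "asymp_eq r c (\<lambda>n. X n - Y n) (\<lambda>n. X' n - Y' n)"
proof -
  note b = assms[THEN asymp_eq_bounded(1)] assms[THEN asymp_eq_bounded(2)]
  show ?thesis
    using asymp_eq_add[OF assms(1) asymp_eq_smult[OF assms(2), of "-1"]]
    by (simp add: minus_mat_eq_add_smult[OF bounded_seqD[OF b(1)] bounded_seqD[OF b(2)]]
      minus_mat_eq_add_smult[OF bounded_seqD[OF b(3)] bounded_seqD[OF b(4)]])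
qed

lemma asymp_eq_mult:
  assumes "asymp_eq r m X X'" "asymp_eq m c Y Y'"
  shows "asymp_eq r c (\<lambda>n. X n * Y n) (\<lambda>n. X' n * Y' n)"
  unfolding asymp_eq_def
proof (intro conjI allI impI)
  note b = assms[THEN asymp_eq_bounded(1)] assms[THEN asymp_eq_bounded(2)]
  fix e :: real assume e: "e > 0"
  obtain C where C: "0 \<le> C" "\<And>n. op_bound (X n) C" using b(1) by (auto simp: bounded_seq_def)
  obtain D where D: "0 \<le> D" "\<And>n. op_bound (Y' n) D" using b(4) by (auto simp: bounded_seq_def)
  have pos: "e / (2 * (C + 1)) > 0" "e / (2 * (D + 1)) > 0" using e C(1) D(1) by auto
  have small: "C * (e / (2 * (C + 1))) \<le> e / 2" "e / (2 * (D + 1)) * D \<le> e / 2"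
    using e C(1) D(1) by (auto simp: field_simps)
  have "\<forall>\<^sub>F n in sequentially. op_bound (X n - X' n) (e / (2 * (D + 1)))"
    "\<forall>\<^sub>F n in sequentially. op_bound (Y n - Y' n) (e / (2 * (C + 1)))"
    using asymp_eqD[OF assms(1) pos(2)] asymp_eqD[OF assms(2) pos(1)] by auto
  then show "\<forall>\<^sub>F n in sequentially. op_bound (X n * Y n - X' n * Y' n) e"
  proof eventually_elim
    case (elim n)
    note c = b[THEN bounded_seqD, of n]
    have "X n * Y n - X' n * Y' n = X n * (Y n - Y' n) + (X n - X' n) * Y' n"
      using c mult_carrier_mat[OF c(1,2)] mult_carrier_mat[OF c(1,4)] mult_carrier_mat[OF c(3,4)]
      by (simp add: mult_minus_distrib_mat[OF c(1,2,4)] minus_mult_distrib_mat[OF c(1,3,4)])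
        (intro eq_matI, auto)
    moreover have "op_bound (X n * (Y n - Y' n)) (C * (e / (2 * (C + 1))))"
      using op_bound_mult[OF C(2) elim(2) c(1) minus_carrier_mat[OF c(4)] C(1)] .
    moreover have "op_bound ((X n - X' n) * Y' n) (e / (2 * (D + 1)) * D)"
      using op_bound_mult[OF elim(1) D(2) minus_carrier_mat[OF c(3)] c(4)] pos by simp
    ultimately show ?case
      using op_bound_mono[OF op_bound_add, of "X n * (Y n - Y' n)" _ "(X n - X' n) * Y' n" _ "r n" "c n" e] small
        mult_carrier_mat[OF c(1) minus_carrier_mat[OF c(4)]] mult_carrier_mat[OF minus_carrier_mat[OF c(3)] c(4)]
      by (metis add_mono field_sum_of_halves)
  qed
qed (use assms in \<open>auto intro!: bounded_seq_mult dest: asymp_eq_bounded\<close>)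

section \<open>Finite sums of matrices\<close>

definition mat_sum :: "nat \<Rightarrow> nat \<Rightarrow> ('a \<Rightarrow> complex mat) \<Rightarrow> 'a set \<Rightarrow> complex mat" where
  "mat_sum m n f M = mat m n (\<lambda>(i, j). \<Sum>x\<in>M. f x $$ (i, j))"

lemma mat_sum_carrier [simp]: "mat_sum m n f M \<in> carrier_mat m n"
  by (simp add: mat_sum_def)

lemma mat_sum_empty [simp]: "mat_sum m n f {} = 0\<^sub>m m n"
  by (rule eq_matI) (auto simp: mat_sum_def)

lemma mat_sum_insert:
  assumes "finite M" "x \<notin> M" "f x \<in> carrier_mat m n"
  shows "mat_sum m n f (insert x M) = f x + mat_sum m n f M"
  using assms by (intro eq_matI) (auto simp: mat_sum_def)

lemma mat_sum_cong: "(\<And>x. x \<in> M \<Longrightarrow> f x = g x) \<Longrightarrow> mat_sum m n f M = mat_sum m n g M"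
  by (simp add: mat_sum_def)

lemma mat_sum_reindex: "bij_betw p M M' \<Longrightarrow> mat_sum m n (\<lambda>x. f (p x)) M = mat_sum m n f M'"
  unfolding mat_sum_def
  by (intro arg_cong[of _ _ "mat m n"] ext, clarify) (rule sum.reindex_bij_betw)

lemma mat_sum_const: "A \<in> carrier_mat m n \<Longrightarrow> mat_sum m n (\<lambda>_. A) M = of_nat (card M) \<cdot>\<^sub>m A"
  by (rule eq_matI) (auto simp: mat_sum_def)

lemma mult_mat_sum:
  assumes "A \<in> carrier_mat k m" "\<And>x. x \<in> M \<Longrightarrow> f x \<in> carrier_mat m n"
  shows "A * mat_sum m n f M = mat_sum k n (\<lambda>x. A * f x) M"
proof (rule eq_matI)
  fix i j assume "i < dim_row (mat_sum k n (\<lambda>x. A * f x) M)" "j < dim_col (mat_sum k n (\<lambda>x. A * f x) M)"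
  then have ij: "i < k" "j < n" by (auto simp: mat_sum_def)
  have "(A * mat_sum m n f M) $$ (i, j) = (\<Sum>l<m. \<Sum>x\<in>M. A $$ (i, l) * f x $$ (l, j))"
    using assms(1) ij by (simp add: mat_sum_def scalar_prod_def lessThan_atLeast0 sum_distrib_left)
  also have "\<dots> = (\<Sum>x\<in>M. \<Sum>l<m. A $$ (i, l) * f x $$ (l, j))" by (rule sum.swap)
  also have "\<dots> = (\<Sum>x\<in>M. (A * f x) $$ (i, j))"
  proof (rule sum.cong)
    fix x assume "x \<in> M"
    then show "(\<Sum>l<m. A $$ (i, l) * f x $$ (l, j)) = (A * f x) $$ (i, j)"
      using assms(1) assms(2)[of x] ij by (simp add: scalar_prod_def lessThan_atLeast0)
  qed simp
  finally show "(A * mat_sum m n f M) $$ (i, j) = mat_sum k n (\<lambda>x. A * f x) M $$ (i, j)"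
    using ij by (simp add: mat_sum_def)
qed (use assms in \<open>auto simp: mat_sum_def\<close>)

lemma mat_sum_adjoint:
  assumes "\<And>x. x \<in> M \<Longrightarrow> f x \<in> carrier_mat m n"
  shows "mat_adjoint (mat_sum m n f M) = mat_sum n m (\<lambda>x. mat_adjoint (f x)) M"
proof (rule eq_matI)
  fix i j assume "i < dim_row (mat_sum n m (\<lambda>x. mat_adjoint (f x)) M)" "j < dim_col (mat_sum n m (\<lambda>x. mat_adjoint (f x)) M)"
  then have ij: "i < n" "j < m" by (auto simp: mat_sum_def)
  have "cnj (f x $$ (j, i)) = mat_adjoint (f x) $$ (i, j)" if "x \<in> M" for x
    using assms[OF that] ij by simp
  then show "mat_adjoint (mat_sum m n f M) $$ (i, j) = mat_sum n m (\<lambda>x. mat_adjoint (f x)) M $$ (i, j)"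
    using ij by (simp add: mat_sum_def)
qed (auto simp: mat_sum_def)

lemma mat_sum_mult:
  assumes "A \<in> carrier_mat n k" "\<And>x. x \<in> M \<Longrightarrow> f x \<in> carrier_mat m n"
  shows "mat_sum m n f M * A = mat_sum m k (\<lambda>x. f x * A) M"
proof -
  have "mat_adjoint (mat_sum m n f M * A) = mat_adjoint (mat_sum m k (\<lambda>x. f x * A) M)"
    using assms
    by (simp add: mat_adjoint_mult[of _ m n _ k] mat_sum_adjoint mult_mat_sum[of _ k n] mult_carrier_mat[of _ m n _ k]
        cong: mat_sum_cong)
  then show ?thesis by (metis mat_adjoint_adjoint)
qed

lemma asymp_eq_mat_sum:
  assumes "finite M" "\<And>x. x \<in> M \<Longrightarrow> asymp_eq r c (X x) (Y x)"
  shows "asymp_eq r c (\<lambda>n. mat_sum (r n) (c n) (\<lambda>x. X x n) M) (\<lambda>n. mat_sum (r n) (c n) (\<lambda>x. Y x n) M)"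
  using assms
proof (induction M)
  case empty
  then show ?case by (simp add: asymp_eq_refl bounded_seq_zero)
next
  case (insert x M)
  have "X x n \<in> carrier_mat (r n) (c n)" "Y x n \<in> carrier_mat (r n) (c n)" for n
    using insert.prems[of x] by (auto simp: asymp_eq_def dest: bounded_seqD)
  then show ?case
    using insert asymp_eq_add[of r c "X x" "Y x"] by (simp add: mat_sum_insert)
qed

lemma bounded_seq_mat_sum:
  assumes "finite M" "\<And>x. x \<in> M \<Longrightarrow> bounded_seq r c (X x)"
  shows "bounded_seq r c (\<lambda>n. mat_sum (r n) (c n) (\<lambda>x. X x n) M)"
  using asymp_eq_mat_sum[OF assms(1), of r c X X] assms(2) asymp_eq_refl asymp_eq_bounded(1) by blast

section \<open>Asymptotic representations in operator norm\<close>

locale op_asymptotic_rep = group G for G (structure) +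
  fixes d :: "nat \<Rightarrow> nat" and \<phi> :: "nat \<Rightarrow> 'a \<Rightarrow> complex mat"
  assumes unitary: "g \<in> carrier G \<Longrightarrow> \<phi> n g \<in> unitary_matrices (d n)"
    and mult: "g \<in> carrier G \<Longrightarrow> h \<in> carrier G \<Longrightarrow>
      asymp_eq d d (\<lambda>n. \<phi> n (g \<otimes> h)) (\<lambda>n. \<phi> n g * \<phi> n h)"
begin

lemma bounded: "g \<in> carrier G \<Longrightarrow> bounded_seq d d (\<lambda>n. \<phi> n g)"
  by (rule bounded_seq_unitary) (rule unitary)

lemma dims [simp]: "g \<in> carrier G \<Longrightarrow> \<phi> n g \<in> carrier_mat (d n) (d n)"
  using unitary unitary_matricesD(1) by blast

lemma adjoint_cancel:
  assumes "g \<in> carrier G" "X \<in> carrier_mat (d n) k"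
  shows "mat_adjoint (\<phi> n g) * (\<phi> n g * X) = X"
proof -
  note u = unitary_matricesD[OF unitary[OF assms(1)], of n]
  have "mat_adjoint (\<phi> n g) * (\<phi> n g * X) = (mat_adjoint (\<phi> n g) * \<phi> n g) * X"
    by (rule assoc_mult_mat[symmetric]) (use u(1) assms(2) in auto)
  then show ?thesis using assms(2) by (simp add: u(2))
qed

lemma cancel_left:
  assumes "g \<in> carrier G" "asymp_eq d d (\<lambda>n. \<phi> n g * X n) (\<lambda>n. \<phi> n g * Y n)"
    "bounded_seq d d X" "bounded_seq d d Y"
  shows "asymp_eq d d X Y"
  using asymp_eq_mult[OF asymp_eq_refl[OF bounded_seq_adjoint[OF bounded[OF assms(1)]]] assms(2)]
  by (simp add: adjoint_cancel[OF assms(1) bounded_seqD[OF assms(3)]] adjoint_cancel[OF assms(1) bounded_seqD[OF assms(4)]])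

lemma one: "asymp_eq d d (\<lambda>n. \<phi> n \<one>) (\<lambda>n. 1\<^sub>m (d n))"
proof (rule cancel_left[OF one_closed _ bounded[OF one_closed] bounded_seq_one])
  show "asymp_eq d d (\<lambda>n. \<phi> n \<one> * \<phi> n \<one>) (\<lambda>n. \<phi> n \<one> * 1\<^sub>m (d n))"
    using asymp_eq_sym[OF mult[OF one_closed one_closed]] by (simp add: right_mult_one_mat[OF dims[OF one_closed]])
qed

lemma inverse:
  assumes g: "g \<in> carrier G"
  shows "asymp_eq d d (\<lambda>n. \<phi> n (inv g)) (\<lambda>n. mat_adjoint (\<phi> n g))"
proof (rule cancel_left[OF g])
  have "asymp_eq d d (\<lambda>n. \<phi> n g * \<phi> n (inv g)) (\<lambda>n. \<phi> n (g \<otimes> inv g))"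
    using g by (intro asymp_eq_sym[OF mult]) auto
  also have "asymp_eq d d \<dots> (\<lambda>n. 1\<^sub>m (d n))" using one g by simp
  also have "(\<lambda>n. 1\<^sub>m (d n)) = (\<lambda>n. \<phi> n g * mat_adjoint (\<phi> n g))"
    using unitary_matricesD(3)[OF unitary[OF g]] by simp
  finally show "asymp_eq d d (\<lambda>n. \<phi> n g * \<phi> n (inv g)) (\<lambda>n. \<phi> n g * mat_adjoint (\<phi> n g))" .
qed (use g in \<open>auto intro: bounded bounded_seq_adjoint\<close>)

end

text \<open>
  Averaging over a finite normal subgroup \<open>M\<close> gives asymptotically the projection onto the
  \<open>M\<close>-fixed vectors, and normality makes it commute asymptotically with every \<open>\<phi>(g)\<close>.
\<close>

locale op_asymptotic_rep_normal = op_asymptotic_rep +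
  fixes M
  assumes normal_M: "M \<lhd> G" and finite_M: "finite M"
begin

definition average :: "nat \<Rightarrow> complex mat" where
  "average n = (1 / of_nat (card M)) \<cdot>\<^sub>m mat_sum (d n) (d n) (\<phi> n) M"

lemma M_subset: "M \<subseteq> carrier G"
  using normal_M normal_imp_subgroup subgroup.subset by blast

lemma M_closed: "x \<in> M \<Longrightarrow> x \<in> carrier G"
  using M_subset by blast

lemma M_nonempty: "card M \<noteq> 0"
  using finite_M subgroup.one_closed[OF normal_imp_subgroup[OF normal_M]] by auto

lemma bounded_sum: "bounded_seq d d (\<lambda>n. mat_sum (d n) (d n) (\<phi> n) M)"
  using bounded_seq_mat_sum[OF finite_M, of d d "\<lambda>x n. \<phi> n x"] bounded M_closed by auto

lemma bounded_average: "bounded_seq d d average"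
  using bounded_seq_smult[OF bounded_sum] by (simp add: average_def[abs_def])

lemma average_dims [simp]: "average n \<in> carrier_mat (d n) (d n)"
  using bounded_average by (rule bounded_seqD)

text \<open>
  The common argument for the next three lemmas: an asymptotic equality between families
  indexed by \<open>M\<close>, up to a permutation of \<open>M\<close>, passes to the averages.
\<close>

lemma average_permute:
  assumes p: "bij_betw p M M"
    and XY: "\<And>x. x \<in> M \<Longrightarrow> asymp_eq d d (X x) (Y (p x))"
    and A: "\<And>n. mat_sum (d n) (d n) (\<lambda>x. X x n) M = A n"
    and B: "\<And>n. mat_sum (d n) (d n) (\<lambda>x. Y x n) M = B n"
  shows "asymp_eq d d (\<lambda>n. (1 / of_nat (card M)) \<cdot>\<^sub>m A n) (\<lambda>n. (1 / of_nat (card M)) \<cdot>\<^sub>m B n)"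
proof -
  have "asymp_eq d d (\<lambda>n. mat_sum (d n) (d n) (\<lambda>x. X x n) M) (\<lambda>n. mat_sum (d n) (d n) (\<lambda>x. Y (p x) n) M)"
    by (rule asymp_eq_mat_sum[OF finite_M XY])
  then show ?thesis
    using asymp_eq_smult A B mat_sum_reindex[OF p, of "d _" "d _" "\<lambda>x. Y x _"] by auto
qed

lemma average_adjoint: "asymp_eq d d (\<lambda>n. mat_adjoint (average n)) average"
proof -
  have p: "bij_betw (\<lambda>x. inv x) M M"
    by (rule bij_betw_byWitness[where f' = "\<lambda>x. inv x"])
      (use M_closed subgroup.m_inv_closed[OF normal_imp_subgroup[OF normal_M]] in auto)
  have "asymp_eq d d (\<lambda>n. (1 / of_nat (card M)) \<cdot>\<^sub>m mat_sum (d n) (d n) (\<lambda>x. mat_adjoint (\<phi> n x)) M)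
     (\<lambda>n. (1 / of_nat (card M)) \<cdot>\<^sub>m mat_sum (d n) (d n) (\<phi> n) M)"
    by (rule average_permute[OF p, where X = "\<lambda>x n. mat_adjoint (\<phi> n x)" and Y = "\<lambda>x n. \<phi> n x"])
      (auto intro: asymp_eq_sym[OF inverse] M_closed)
  then show ?thesis
    using M_closed by (simp add: average_def[abs_def] mat_adjoint_smult mat_sum_adjoint)
qed

text \<open>
  Conjugation by \<open>g\<close> permutes the normal subgroup \<open>M\<close>.
\<close>

lemma average_commute:
  assumes g: "g \<in> carrier G"
  shows "asymp_eq d d (\<lambda>n. \<phi> n g * average n) (\<lambda>n. average n * \<phi> n g)"
proof -
  have cl: "g \<otimes> x \<otimes> inv g \<in> M" "inv g \<otimes> x \<otimes> g \<in> M" if "x \<in> M" for x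
    using normal.inv_op_closed2[OF normal_M g that] normal.inv_op_closed1[OF normal_M g that] by auto
  have inv_cancel: "inv g \<otimes> (g \<otimes> x) = x" "g \<otimes> (inv g \<otimes> x) = x" if "x \<in> carrier G" for x
    using g that by (simp_all add: m_assoc[symmetric])
  have p: "bij_betw (\<lambda>x. g \<otimes> x \<otimes> inv g) M M"
    by (rule bij_betw_byWitness[where f' = "\<lambda>x. inv g \<otimes> x \<otimes> g"])
      (use cl g M_closed in \<open>auto simp: m_assoc inv_cancel\<close>)
  have "asymp_eq d d (\<lambda>n. (1 / of_nat (card M)) \<cdot>\<^sub>m (\<phi> n g * mat_sum (d n) (d n) (\<phi> n) M))
     (\<lambda>n. (1 / of_nat (card M)) \<cdot>\<^sub>m (mat_sum (d n) (d n) (\<phi> n) M * \<phi> n g))"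
  proof (rule average_permute[OF p, where X = "\<lambda>x n. \<phi> n g * \<phi> n x" and Y = "\<lambda>x n. \<phi> n x * \<phi> n g"])
    fix x assume x: "x \<in> M"
    note x' = M_closed[OF x]
    have "asymp_eq d d (\<lambda>n. \<phi> n g * \<phi> n x) (\<lambda>n. \<phi> n (g \<otimes> x))"
      using g x' by (intro asymp_eq_sym[OF mult])
    also have "g \<otimes> x = (g \<otimes> x \<otimes> inv g) \<otimes> g" using g x' by (simp add: m_assoc)
    also have "asymp_eq d d (\<lambda>n. \<phi> n \<dots>) (\<lambda>n. \<phi> n (g \<otimes> x \<otimes> inv g) * \<phi> n g)"
      using g x' by (intro mult) auto
    finally show "asymp_eq d d (\<lambda>n. \<phi> n g * \<phi> n x) (\<lambda>n. \<phi> n (g \<otimes> x \<otimes> inv g) * \<phi> n g)" .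
  qed (simp_all add: mult_mat_sum[OF dims[OF g]] mat_sum_mult[OF dims[OF g]] M_closed)
  then show ?thesis
    using g by (simp add: average_def[abs_def] mult_smult_distrib[OF dims[OF g] mat_sum_carrier]
      mult_smult_assoc_mat[OF mat_sum_carrier dims[OF g]])
qed

lemma average_absorb:
  assumes g: "g \<in> M"
  shows "asymp_eq d d (\<lambda>n. \<phi> n g * average n) average"
proof -
  note g' = M_closed[OF g] and sg = normal_imp_subgroup[OF normal_M]
  have p: "bij_betw (\<lambda>x. g \<otimes> x) M M"
    by (rule bij_betw_byWitness[where f' = "\<lambda>x. inv g \<otimes> x"])
      (use subgroup.m_closed[OF sg] subgroup.m_inv_closed[OF sg] g M_closed in \<open>auto simp: m_assoc[symmetric]\<close>)
  have "asymp_eq d d (\<lambda>n. (1 / of_nat (card M)) \<cdot>\<^sub>m (\<phi> n g * mat_sum (d n) (d n) (\<phi> n) M))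
     (\<lambda>n. (1 / of_nat (card M)) \<cdot>\<^sub>m mat_sum (d n) (d n) (\<phi> n) M)"
    by (rule average_permute[OF p, where X = "\<lambda>x n. \<phi> n g * \<phi> n x" and Y = "\<lambda>x n. \<phi> n x"])
      (use g' M_closed in \<open>auto simp: mult_mat_sum[OF dims[OF g']] intro: asymp_eq_sym[OF mult]\<close>)
  then show ?thesis
    using g' by (simp add: average_def[abs_def] mult_smult_distrib[OF dims[OF g'] mat_sum_carrier])
qed

lemma average_idem: "asymp_eq d d (\<lambda>n. average n * average n) average"
proof -
  have "asymp_eq d d (\<lambda>n. mat_sum (d n) (d n) (\<lambda>x. \<phi> n x * average n) M) (\<lambda>n. mat_sum (d n) (d n) (\<lambda>x. average n) M)"
    by (rule asymp_eq_mat_sum[OF finite_M average_absorb])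
  then have "asymp_eq d d (\<lambda>n. mat_sum (d n) (d n) (\<phi> n) M * average n) (\<lambda>n. of_nat (card M) \<cdot>\<^sub>m average n)"
    using M_closed by (simp add: mat_sum_mult[OF average_dims] mat_sum_const[OF average_dims])
  from asymp_eq_smult[OF this, of "1 / of_nat (card M)"]
  have "asymp_eq d d (\<lambda>n. (1 / of_nat (card M)) \<cdot>\<^sub>m (mat_sum (d n) (d n) (\<phi> n) M * average n))
      (\<lambda>n. (1 / of_nat (card M)) \<cdot>\<^sub>m (of_nat (card M) \<cdot>\<^sub>m average n))" .
  moreover have "(1 / of_nat (card M)) \<cdot>\<^sub>m (of_nat (card M) \<cdot>\<^sub>m average n) = average n" for n
    using M_nonempty by (intro eq_matI) auto
  moreover have "(1 / of_nat (card M)) \<cdot>\<^sub>m (mat_sum (d n) (d n) (\<phi> n) M * average n) = average n * average n" for n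
  proof -
    have "average n * average n = (1 / of_nat (card M)) \<cdot>\<^sub>m mat_sum (d n) (d n) (\<phi> n) M * average n"
      by (simp only: average_def)
    then show ?thesis by (simp only: mult_smult_assoc_mat[OF mat_sum_carrier average_dims])
  qed
  ultimately show ?thesis by simp
qed

end

section \<open>Compression to the complement of the fixed vectors\<close>

lemma mult_assoc_dim:
  fixes A B C :: "complex mat"
  shows "dim_col A = dim_row B \<Longrightarrow> dim_col B = dim_row C \<Longrightarrow> A * B * C = A * (B * C)"
  by (rule assoc_mult_mat) auto

context op_asymptotic_rep_normal
begin

definition complement :: "nat \<Rightarrow> complex mat" where
  "complement n = 1\<^sub>m (d n) - average n"

text \<open>
  The matrix \<open>complement n\<close> is only asymptotically Hermitian. Its Hermitian part is exactly
  so, hence diagonalizable.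
\<close>

definition hermitian_complement :: "nat \<Rightarrow> complex mat" where
  "hermitian_complement n = 1\<^sub>m (d n) - (1/2) \<cdot>\<^sub>m (average n + mat_adjoint (average n))"

lemma complement_dims [simp]: "complement n \<in> carrier_mat (d n) (d n)"
  by (simp add: complement_def minus_carrier_mat)

lemma hermitian_complement_dims [simp]: "hermitian_complement n \<in> carrier_mat (d n) (d n)"
  unfolding hermitian_complement_def using average_dims[of n]
  by (intro minus_carrier_mat smult_carrier_mat add_carrier_mat mat_adjoint_carrier)

lemma hermitian_complement_adjoint: "mat_adjoint (hermitian_complement n) = hermitian_complement n"
  unfolding hermitian_complement_def
  by (intro eq_matI) (auto simp: carrier_matD[OF average_dims])

lemma bounded_complement: "bounded_seq d d complement"
  using bounded_seq_diff[OF bounded_seq_one bounded_average] by (simp add: complement_def[abs_def])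

lemma hermitian_complement: "asymp_eq d d hermitian_complement complement"
proof -
  have "asymp_eq d d (\<lambda>n. 1\<^sub>m (d n) - (1/2) \<cdot>\<^sub>m (average n + mat_adjoint (average n)))
      (\<lambda>n. 1\<^sub>m (d n) - (1/2) \<cdot>\<^sub>m (average n + average n))"
    by (intro asymp_eq_diff asymp_eq_smult asymp_eq_add asymp_eq_refl bounded_seq_one bounded_average average_adjoint)
  moreover have "(1/2) \<cdot>\<^sub>m (average n + average n) = average n" for n
    by (rule eq_matI) auto
  ultimately show ?thesis by (simp add: complement_def[abs_def] hermitian_complement_def[abs_def])
qed

lemma complement_idem: "asymp_eq d d (\<lambda>n. complement n * complement n) complement"
proof -
  have "complement n * complement n = complement n - (average n - average n * average n)" for n
  proof -
    have "complement n * complement n = complement n * 1\<^sub>m (d n) - complement n * average n"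
      using mult_minus_distrib_mat[OF complement_dims one_carrier_mat average_dims, of n] by (simp add: complement_def)
    also have "complement n * average n = 1\<^sub>m (d n) * average n - average n * average n"
      unfolding complement_def by (rule minus_mult_distrib_mat[OF one_carrier_mat average_dims average_dims])
    finally show ?thesis by (simp add: right_mult_one_mat[OF complement_dims] left_mult_one_mat[OF average_dims])
  qed
  moreover have "asymp_eq d d (\<lambda>n. complement n - (average n - average n * average n))
      (\<lambda>n. complement n - (average n - average n))"
    by (intro asymp_eq_diff asymp_eq_refl bounded_complement bounded_average average_idem)
  moreover have "complement n - (average n - average n) = complement n" for n
    by (intro eq_matI) (auto simp: carrier_matD[OF average_dims] carrier_matD[OF complement_dims])
  ultimately show ?thesis by simp
qed

lemma complement_commute:
  assumes g: "g \<in> carrier G"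
  shows "asymp_eq d d (\<lambda>n. \<phi> n g * complement n) (\<lambda>n. complement n * \<phi> n g)"
proof -
  have "\<phi> n g * complement n = \<phi> n g - \<phi> n g * average n" for n
    unfolding complement_def using mult_minus_distrib_mat[OF dims[OF g] one_carrier_mat average_dims]
    by (simp add: right_mult_one_mat[OF dims[OF g]])
  moreover have "complement n * \<phi> n g = \<phi> n g - average n * \<phi> n g" for n
    unfolding complement_def using minus_mult_distrib_mat[OF one_carrier_mat average_dims dims[OF g]]
    by (simp add: left_mult_one_mat[OF dims[OF g]])
  moreover have "asymp_eq d d (\<lambda>n. \<phi> n g - \<phi> n g * average n) (\<lambda>n. \<phi> n g - average n * \<phi> n g)"
    by (intro asymp_eq_diff asymp_eq_refl bounded g average_commute)
  ultimately show ?thesis by simp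
qed

text \<open>
  Asymptotically \<open>complement n\<close> is a projection that commutes with every \<open>\<phi>(g)\<close>. Rounding it to
  an exact projection \<open>V\<^sup>* V\<close> turns \<open>V \<phi>(g) V\<^sup>*\<close> into an asymptotically multiplicative family of
  almost unitary matrices on its range, and \<open>\<psi>(g)\<close> is a nearby unitary. The average over \<open>M\<close>,
  asymptotically the complementary projection, has compressions tending to \<open>0\<close>. If the range were \<open>0\<close> for infinitely many
  \<open>n\<close>, then each \<open>\<phi>(h)\<close> with \<open>h \<in> M\<close> would come arbitrarily close to \<open>1\<close> in operator norm.
\<close>

theorem compression:
  obtains e \<psi> where "op_asymptotic_rep G e \<psi>" "\<And>n. e n \<le> d n"
    "asymp_eq e e (\<lambda>n. mat_sum (e n) (e n) (\<psi> n) M) (\<lambda>n. 0\<^sub>m (e n) (e n))"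
    "\<And>h c. h \<in> M \<Longrightarrow> 0 < c \<Longrightarrow> \<forall>\<^sub>F n in sequentially. \<not> op_bound (\<phi> n h - 1\<^sub>m (d n)) c \<Longrightarrow>
       \<forall>\<^sub>F n in sequentially. e n \<noteq> 0"
proof -
  let ?H = hermitian_complement
  obtain e V where e: "\<And>n. e n \<le> d n" and V: "\<And>n. V n \<in> carrier_mat (e n) (d n)"
    and VV: "\<And>n. V n * mat_adjoint (V n) = 1\<^sub>m (e n)"
    and qH: "\<And>n c. 0 \<le> c \<Longrightarrow> op_bound (?H n * ?H n - ?H n) c \<Longrightarrow> op_bound (mat_adjoint (V n) * V n - ?H n) (2 * c)"
    using almost_projection_range[OF hermitian_complement_dims hermitian_complement_adjoint] by metis
  note V' = mat_adjoint_carrier[OF V]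
  have dimV [simp]: "dim_row (V n) = e n" "dim_col (V n) = d n" for n using V[of n] by auto
  have dim\<phi>: "dim_row (\<phi> n g) = d n" "dim_col (\<phi> n g) = d n" if "g \<in> carrier G" for n g using carrier_matD[OF dims[OF that]] by auto
  have VV_cancel: "V n * (mat_adjoint (V n) * X) = X" if "dim_row X = e n" for n X
  proof -
    have "V n * (mat_adjoint (V n) * X) = (V n * mat_adjoint (V n)) * X"
      using that by (intro mult_assoc_dim[symmetric]) auto
    then show ?thesis using that by (simp add: VV left_mult_one_mat')
  qed
  have bV: "bounded_seq e d V"
    by (rule bounded_seqI[OF V, of 1]) (auto intro: op_bound_coisometry[OF V VV])
  note bV' = bounded_seq_adjoint[OF bV]
  define q where "q n = mat_adjoint (V n) * V n" for n
  have q_dims: "q n \<in> carrier_mat (d n) (d n)" for n unfolding q_def using mult_carrier_mat[OF V' V] .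
  have bq: "bounded_seq d d q" unfolding q_def by (rule bounded_seq_mult[OF bV' bV])
  note HK = hermitian_complement
  have "asymp_eq d d (\<lambda>n. ?H n * ?H n) (\<lambda>n. complement n * complement n)"
    by (rule asymp_eq_mult[OF HK HK])
  also note complement_idem
  also note asymp_eq_sym[OF HK]
  finally have HH: "asymp_eq d d (\<lambda>n. ?H n * ?H n) ?H" .
  have "asymp_eq d d q ?H"
    unfolding asymp_eq_def
  proof (intro conjI allI impI)
    fix r :: real assume r: "r > 0"
    then have "\<forall>\<^sub>F n in sequentially. op_bound (?H n * ?H n - ?H n) (r / 2)"
      by (intro asymp_eqD[OF HH]) simp
    then show "\<forall>\<^sub>F n in sequentially. op_bound (q n - ?H n) r"
      by eventually_elim (use r qH[of "r / 2"] in \<open>simp add: q_def\<close>)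
  qed (use bq asymp_eq_bounded(1)[OF HK] in auto)
  also note HK
  finally have qK: "asymp_eq d d q complement" .
  have q_commute: "asymp_eq d d (\<lambda>n. \<phi> n g * q n) (\<lambda>n. q n * \<phi> n g)" if g: "g \<in> carrier G" for g
  proof -
    have "asymp_eq d d (\<lambda>n. \<phi> n g * q n) (\<lambda>n. \<phi> n g * complement n)"
      by (rule asymp_eq_mult[OF asymp_eq_refl[OF bounded[OF g]] qK])
    also note complement_commute[OF g]
    also have "asymp_eq d d (\<lambda>n. complement n * \<phi> n g) (\<lambda>n. q n * \<phi> n g)"
      by (rule asymp_eq_mult[OF asymp_eq_sym[OF qK] asymp_eq_refl[OF bounded[OF g]]])
    finally show ?thesis .
  qed
  define w where "w n X = V n * X * mat_adjoint (V n)" for n X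
  have w_cong: "asymp_eq e e (\<lambda>n. w n (X n)) (\<lambda>n. w n (Y n))" if "asymp_eq d d X Y" for X Y
    unfolding w_def
    by (rule asymp_eq_mult[OF asymp_eq_mult[OF asymp_eq_refl[OF bV] that] asymp_eq_refl[OF bV']])
  have w_dims: "w n X \<in> carrier_mat (e n) (e n)" if "X \<in> carrier_mat (d n) (d n)" for n X
    unfolding w_def using V V' that by (intro mult_carrier_mat)
  have w_one: "w n (1\<^sub>m (d n)) = 1\<^sub>m (e n)" for n
    unfolding w_def using VV by (simp add: right_mult_one_mat[OF V])
  \<comment> \<open>move \<open>q = V\<^sup>* V\<close> past \<open>\<phi>(g)\<close>, where it is absorbed by \<open>V q = V\<close>\<close>
  have w_mult: "asymp_eq e e (\<lambda>n. w n (\<phi> n g) * w n (\<phi> n h)) (\<lambda>n. w n (\<phi> n (g \<otimes> h)))"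
    if g: "g \<in> carrier G" and h: "h \<in> carrier G" for g h
  proof -
    have "asymp_eq e e (\<lambda>n. V n * (\<phi> n g * q n) * (\<phi> n h * mat_adjoint (V n)))
        (\<lambda>n. V n * (q n * \<phi> n g) * (\<phi> n h * mat_adjoint (V n)))"
      by (rule asymp_eq_mult[OF asymp_eq_mult[OF asymp_eq_refl[OF bV] q_commute[OF g]]
            asymp_eq_mult[OF asymp_eq_refl[OF bounded[OF h]] asymp_eq_refl[OF bV']]])
    moreover have "V n * (\<phi> n g * q n) * (\<phi> n h * mat_adjoint (V n)) = w n (\<phi> n g) * w n (\<phi> n h)" for n
      using g h by (simp add: w_def q_def mult_assoc_dim dim\<phi>)
    moreover have "V n * (q n * \<phi> n g) * (\<phi> n h * mat_adjoint (V n)) = w n (\<phi> n g * \<phi> n h)" for n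
      using g h by (simp add: w_def q_def mult_assoc_dim dim\<phi> VV_cancel)
    ultimately have "asymp_eq e e (\<lambda>n. w n (\<phi> n g) * w n (\<phi> n h)) (\<lambda>n. w n (\<phi> n g * \<phi> n h))" by simp
    also have "asymp_eq e e \<dots> (\<lambda>n. w n (\<phi> n (g \<otimes> h)))"
      by (intro w_cong asymp_eq_sym[OF mult] g h)
    finally show ?thesis .
  qed
  have w_adjoint: "mat_adjoint (w n X) = w n (mat_adjoint X)" if "X \<in> carrier_mat (d n) (d n)" for n X
    unfolding w_def mat_adjoint_mult[OF mult_carrier_mat[OF V that] V'] mat_adjoint_mult[OF V that]
    using assoc_mult_mat[OF V mat_adjoint_carrier[OF that] V'] by simp
  have w_unitary: "asymp_eq e e (\<lambda>n. mat_adjoint (w n (\<phi> n g)) * w n (\<phi> n g)) (\<lambda>n. 1\<^sub>m (e n))"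
    if g: "g \<in> carrier G" for g
  proof -
    have "asymp_eq e e (\<lambda>n. w n (mat_adjoint (\<phi> n g)) * w n (\<phi> n g)) (\<lambda>n. w n (\<phi> n (inv g)) * w n (\<phi> n g))"
    proof (rule asymp_eq_mult)
      show "asymp_eq e e (\<lambda>n. w n (mat_adjoint (\<phi> n g))) (\<lambda>n. w n (\<phi> n (inv g)))"
        by (intro w_cong asymp_eq_sym[OF inverse] g)
      show "asymp_eq e e (\<lambda>n. w n (\<phi> n g)) (\<lambda>n. w n (\<phi> n g))"
        by (intro w_cong asymp_eq_refl bounded g)
    qed
    also have "asymp_eq e e \<dots> (\<lambda>n. w n (\<phi> n (inv g \<otimes> g)))"
      using g by (intro w_mult) auto
    also have "asymp_eq e e \<dots> (\<lambda>n. w n (1\<^sub>m (d n)))"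
      using g by (intro w_cong) (simp add: one)
    finally show ?thesis by (simp add: w_one w_adjoint[OF dims[OF g]])
  qed
  define rounding where "rounding n g u \<longleftrightarrow> u \<in> unitary_matrices (e n) \<and>
      (\<forall>c. 0 \<le> c \<longrightarrow> c < 1 \<longrightarrow> op_bound (mat_adjoint (w n (\<phi> n g)) * w n (\<phi> n g) - 1\<^sub>m (e n)) c \<longrightarrow>
        op_bound (u - w n (\<phi> n g)) c)" for n g u
  define \<psi> where "\<psi> n g = (SOME u. rounding n g u)" for n g
  have "rounding n g (\<psi> n g)" if g: "g \<in> carrier G" for n g
  proof -
    obtain u where "u \<in> unitary_matrices (e n)" "\<forall>c. 0 \<le> c \<longrightarrow> c < 1 \<longrightarrow>
        op_bound (mat_adjoint (w n (\<phi> n g)) * w n (\<phi> n g) - 1\<^sub>m (e n)) c \<longrightarrow> op_bound (u - w n (\<phi> n g)) c"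
      using almost_unitary_near_unitary[OF w_dims[where n = n, OF dims[OF g]]] by (elim bexE)
    then have "rounding n g u" unfolding rounding_def by (rule conjI)
    then show ?thesis unfolding \<psi>_def by (rule someI)
  qed
  note \<psi>_rounding = this[unfolded rounding_def]
  have \<psi>: "\<And>n g. g \<in> carrier G \<Longrightarrow> \<psi> n g \<in> unitary_matrices (e n)"
    and \<psi>w: "\<And>n g c. g \<in> carrier G \<Longrightarrow> 0 \<le> c \<Longrightarrow> c < 1 \<Longrightarrow>
      op_bound (mat_adjoint (w n (\<phi> n g)) * w n (\<phi> n g) - 1\<^sub>m (e n)) c \<Longrightarrow> op_bound (\<psi> n g - w n (\<phi> n g)) c"
    using \<psi>_rounding by (iprover, iprover)
  have near: "asymp_eq e e (\<lambda>n. \<psi> n g) (\<lambda>n. w n (\<phi> n g))" if g: "g \<in> carrier G" for g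
    unfolding asymp_eq_def
  proof (intro conjI allI impI)
    show "bounded_seq e e (\<lambda>n. \<psi> n g)" by (rule bounded_seq_unitary) (rule \<psi>[OF g])
    show "bounded_seq e e (\<lambda>n. w n (\<phi> n g))"
      using w_cong[OF asymp_eq_refl[OF bounded[OF g]]] by (rule asymp_eq_bounded(1))
    fix r :: real assume r: "r > 0"
    \<comment> \<open>the rounding bound requires a constant below \<open>1\<close>\<close>
    let ?c = "min r (1/2)"
    have "\<forall>\<^sub>F n in sequentially. op_bound (mat_adjoint (w n (\<phi> n g)) * w n (\<phi> n g) - 1\<^sub>m (e n)) ?c"
      using r by (intro asymp_eqD[OF w_unitary[OF g]]) auto
    then show "\<forall>\<^sub>F n in sequentially. op_bound (\<psi> n g - w n (\<phi> n g)) r"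
    proof eventually_elim
      case (elim n)
      show ?case by (rule op_bound_mono[OF \<psi>w[OF g _ _ elim]]) (use r in auto)
    qed
  qed
  have rep: "op_asymptotic_rep G e \<psi>"
  proof
    fix g h n assume g: "g \<in> carrier G"
    show "\<psi> n g \<in> unitary_matrices (e n)" by (rule \<psi>[OF g])
    assume h: "h \<in> carrier G"
    have "asymp_eq e e (\<lambda>n. \<psi> n (g \<otimes> h)) (\<lambda>n. w n (\<phi> n (g \<otimes> h)))" using g h by (intro near) auto
    also have "asymp_eq e e \<dots> (\<lambda>n. w n (\<phi> n g) * w n (\<phi> n h))" by (rule asymp_eq_sym[OF w_mult[OF g h]])
    also have "asymp_eq e e \<dots> (\<lambda>n. \<psi> n g * \<psi> n h)"
      by (rule asymp_eq_mult[OF asymp_eq_sym[OF near[OF g]] asymp_eq_sym[OF near[OF h]]])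
    finally show "asymp_eq e e (\<lambda>n. \<psi> n (g \<otimes> h)) (\<lambda>n. \<psi> n g * \<psi> n h)" .
  qed
  have "asymp_eq d d (\<lambda>n. 1\<^sub>m (d n) - complement n) (\<lambda>n. 1\<^sub>m (d n) - q n)"
    by (intro asymp_eq_diff asymp_eq_refl bounded_seq_one asymp_eq_sym[OF qK])
  moreover have "1\<^sub>m (d n) - complement n = average n" for n
    by (intro eq_matI) (auto simp: complement_def carrier_matD[OF average_dims])
  ultimately have "asymp_eq d d average (\<lambda>n. 1\<^sub>m (d n) - q n)" by simp
  then have "asymp_eq e e (\<lambda>n. w n (average n)) (\<lambda>n. w n (1\<^sub>m (d n) - q n))"
    by (rule w_cong)
  moreover have "w n (1\<^sub>m (d n) - q n) = 0\<^sub>m (e n) (e n)" for n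
  proof -
    have "w n (1\<^sub>m (d n) - q n) = w n (1\<^sub>m (d n)) - w n (q n)"
      unfolding w_def
      by (simp add: mult_minus_distrib_mat[OF V one_carrier_mat q_dims]
          minus_mult_distrib_mat[OF V mult_carrier_mat[OF V q_dims] V'] right_mult_one_mat[OF V])
    also have "w n (q n) = 1\<^sub>m (e n)"
      by (simp add: w_def q_def mult_assoc_dim VV VV_cancel)
    finally show ?thesis by (simp add: w_one)
  qed
  ultimately have w_average: "asymp_eq e e (\<lambda>n. w n (average n)) (\<lambda>n. 0\<^sub>m (e n) (e n))" by simp
  have sum_zero: "asymp_eq e e (\<lambda>n. mat_sum (e n) (e n) (\<psi> n) M) (\<lambda>n. 0\<^sub>m (e n) (e n))"
  proof -
    have "asymp_eq e e (\<lambda>n. mat_sum (e n) (e n) (\<psi> n) M) (\<lambda>n. mat_sum (e n) (e n) (\<lambda>x. w n (\<phi> n x)) M)"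
      using asymp_eq_mat_sum[OF finite_M near[OF M_closed]] by simp
    also have "(\<lambda>n. mat_sum (e n) (e n) (\<lambda>x. w n (\<phi> n x)) M) = (\<lambda>n. of_nat (card M) \<cdot>\<^sub>m w n (average n))"
    proof
      fix n
      have "mat_sum (d n) (d n) (\<phi> n) M = of_nat (card M) \<cdot>\<^sub>m average n"
        using M_nonempty by (intro eq_matI) (auto simp: average_def)
      moreover have "mat_sum (e n) (e n) (\<lambda>x. w n (\<phi> n x)) M = w n (mat_sum (d n) (d n) (\<phi> n) M)"
        unfolding w_def
        by (simp add: mult_mat_sum[OF V] mat_sum_mult[OF V'] M_closed mult_carrier_mat[OF V dims])
      moreover have "w n (k \<cdot>\<^sub>m average n) = k \<cdot>\<^sub>m w n (average n)" for k
        unfolding w_def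
        by (simp add: mult_smult_distrib[OF V average_dims] mult_smult_assoc_mat[OF mult_carrier_mat[OF V average_dims] V'])
      ultimately show "mat_sum (e n) (e n) (\<lambda>x. w n (\<phi> n x)) M = of_nat (card M) \<cdot>\<^sub>m w n (average n)" by simp
    qed
    also have "asymp_eq e e \<dots> (\<lambda>n. of_nat (card M) \<cdot>\<^sub>m 0\<^sub>m (e n) (e n))"
      by (rule asymp_eq_smult[OF w_average])
    finally show ?thesis by simp
  qed
  have nonzero: "\<forall>\<^sub>F n in sequentially. e n \<noteq> 0"
    if h: "h \<in> M" and c: "0 < c" and sep: "\<forall>\<^sub>F n in sequentially. \<not> op_bound (\<phi> n h - 1\<^sub>m (d n)) c" for h c
  proof -
    note h' = M_closed[OF h]
    have "asymp_eq d d (\<lambda>n. \<phi> n h * q n) (\<lambda>n. \<phi> n h * complement n)"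
      by (rule asymp_eq_mult[OF asymp_eq_refl[OF bounded[OF h']] qK])
    also have "(\<lambda>n. \<phi> n h * complement n) = (\<lambda>n. \<phi> n h - \<phi> n h * average n)"
      by (simp add: complement_def mult_minus_distrib_mat[OF dims[OF h'] one_carrier_mat average_dims]
          right_mult_one_mat[OF dims[OF h']])
    also have "asymp_eq d d \<dots> (\<lambda>n. \<phi> n h - average n)"
      by (intro asymp_eq_diff asymp_eq_refl bounded h' average_absorb h)
    finally have "asymp_eq d d (\<lambda>n. \<phi> n h * q n - q n) (\<lambda>n. \<phi> n h - average n - complement n)"
      by (intro asymp_eq_diff qK)
    moreover have "\<phi> n h - average n - complement n = \<phi> n h - 1\<^sub>m (d n)" for n
      by (intro eq_matI) (auto simp: complement_def carrier_matD[OF average_dims] dim\<phi>[OF h'])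
    ultimately have "asymp_eq d d (\<lambda>n. \<phi> n h * q n - q n) (\<lambda>n. \<phi> n h - 1\<^sub>m (d n))" by simp
    from asymp_eqD[OF this c] sep show ?thesis
    proof eventually_elim
      case (elim n)
      show ?case
      proof
        assume "e n = 0"
        then have "q n = 0\<^sub>m (d n) (d n)"
          unfolding q_def by (intro eq_matI) (auto simp: scalar_prod_def)
        then have "\<phi> n h * q n - q n = 0\<^sub>m (d n) (d n)"
          by (simp add: right_mult_zero_mat[OF dims[OF h']])
        then have "op_bound (0\<^sub>m (d n) (d n) - (\<phi> n h - 1\<^sub>m (d n))) c" using elim(1) by simp
        then have "op_bound ((\<phi> n h - 1\<^sub>m (d n)) - 0\<^sub>m (d n) (d n)) c"
          by (rule op_bound_minus_commute[of _ _ _ "d n" "d n"]) (auto simp: minus_carrier_mat)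
        moreover have "(\<phi> n h - 1\<^sub>m (d n)) - 0\<^sub>m (d n) (d n) = \<phi> n h - 1\<^sub>m (d n)"
          by (intro eq_matI) (auto simp: dim\<phi>[OF h'])
        ultimately show False using elim(2) by simp
      qed
    qed
  qed
  show ?thesis by (rule that[OF rep e sum_zero]) (rule nonzero)
qed

end

section \<open>The normalized Hilbert--Schmidt norm\<close>

text \<open>
  The Hilbert--Schmidt norm without normalization; its square is additive over direct sums.
\<close>

definition frobenius :: "complex mat \<Rightarrow> real" where
  "frobenius A = L2_set (\<lambda>p. cmod (A $$ p)) ({..<dim_row A} \<times> {..<dim_col A})"

lemma frobenius_sq: "(frobenius A)\<^sup>2 = (\<Sum>i<dim_row A. \<Sum>j<dim_col A. (cmod (A $$ (i, j)))\<^sup>2)"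
  unfolding frobenius_def L2_set_def
  by (simp add: sum_nonneg case_prod_unfold sum.cartesian_product)

lemma frobenius_nonneg [simp]: "0 \<le> frobenius A"
  by (simp add: frobenius_def)

lemma hs_norm_frobenius:
  assumes "A \<in> carrier_mat n n"
  shows "hs_norm n A = frobenius A / sqrt (real n)"
proof -
  have "mat_trace (mat_adjoint A * A) = (\<Sum>i<n. \<Sum>k<n. complex_of_real ((cmod (A $$ (k, i)))\<^sup>2))"
    unfolding mat_trace_def
    using assms by (auto simp: scalar_prod_def lessThan_atLeast0 complex_norm_square mult.commute simp del: of_real_power intro!: sum.cong)
  also have "\<dots> = complex_of_real (\<Sum>i<n. \<Sum>k<n. (cmod (A $$ (k, i)))\<^sup>2)" by simp
  also have "(\<Sum>i<n. \<Sum>k<n. (cmod (A $$ (k, i)))\<^sup>2) = (frobenius A)\<^sup>2"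
    using assms by (simp add: frobenius_sq sum.swap[of "\<lambda>i k. (cmod (A $$ (k, i)))\<^sup>2"])
  finally show ?thesis by (simp add: hs_norm_def)
qed

lemma hs_norm_zero: "hs_norm n (0\<^sub>m n n) = 0"
proof -
  have "(frobenius (0\<^sub>m n n))\<^sup>2 = 0" unfolding frobenius_sq by simp
  then show ?thesis by (simp add: hs_norm_frobenius)
qed

lemma hs_norm_nonneg: "A \<in> carrier_mat n n \<Longrightarrow> 0 \<le> hs_norm n A"
  by (simp add: hs_norm_frobenius)

lemma frobenius_triangle:
  assumes "A \<in> carrier_mat m n" "B \<in> carrier_mat m n"
  shows "frobenius (A + B) \<le> frobenius A + frobenius B"
proof -
  have "frobenius (A + B) \<le> L2_set (\<lambda>p. cmod (A $$ p) + cmod (B $$ p)) ({..<m} \<times> {..<n})"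
    using assms by (auto simp: frobenius_def intro!: L2_set_mono norm_triangle_ineq)
  also have "\<dots> \<le> frobenius A + frobenius B"
    using L2_set_triangle_ineq[of "\<lambda>p. cmod (A $$ p)" "\<lambda>p. cmod (B $$ p)"] assms
    by (simp add: frobenius_def)
  finally show ?thesis .
qed

lemma hs_norm_triangle:
  assumes "A \<in> carrier_mat n n" "B \<in> carrier_mat n n"
  shows "hs_norm n (A + B) \<le> hs_norm n A + hs_norm n B"
  using frobenius_triangle[OF assms] assms
  by (simp add: hs_norm_frobenius add_divide_distrib[symmetric] divide_right_mono)

lemma hs_norm_diff_triangle:
  assumes "A \<in> carrier_mat n n" "B \<in> carrier_mat n n" "C \<in> carrier_mat n n"
  shows "hs_norm n (A - C) \<le> hs_norm n (A - B) + hs_norm n (B - C)"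
proof -
  have "A - C = (A - B) + (B - C)" using assms by (intro eq_matI) auto
  then show ?thesis
    using hs_norm_triangle[OF minus_carrier_mat[OF assms(2), of A] minus_carrier_mat[OF assms(3), of B]] by simp
qed

lemma hs_norm_adjoint:
  assumes "A \<in> carrier_mat n n"
  shows "hs_norm n (mat_adjoint A) = hs_norm n A"
proof -
  have "(frobenius (mat_adjoint A))\<^sup>2 = (frobenius A)\<^sup>2"
    unfolding frobenius_sq using sum.swap[of "\<lambda>i k. (cmod (A $$ (k, i)))\<^sup>2" "{..<n}" "{..<n}"] assms by simp
  then show ?thesis using assms by (simp add: hs_norm_frobenius)
qed

lemma hs_norm_unitary_left:
  assumes "U \<in> unitary_matrices n" "A \<in> carrier_mat n n"
  shows "hs_norm n (U * A) = hs_norm n A"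
proof -
  note U = unitary_matricesD[OF assms(1)]
  have "mat_adjoint (U * A) * (U * A) = mat_adjoint A * ((mat_adjoint U * U) * A)"
    using U(1) assms(2) by (simp add: mat_adjoint_mult[of _ n n _ n] square_mat_simps[where n = n])
  then show ?thesis using U assms(2) by (simp add: hs_norm_def)
qed

lemma hs_norm_unitary_right:
  assumes "U \<in> unitary_matrices n" "A \<in> carrier_mat n n"
  shows "hs_norm n (A * U) = hs_norm n A"
proof -
  note U = unitary_matricesD(1)[OF assms(1)]
  have "hs_norm n (A * U) = hs_norm n (mat_adjoint U * mat_adjoint A)"
    using U assms(2) hs_norm_adjoint[of "A * U" n] by (simp add: mat_adjoint_mult[of _ n n _ n])
  then show ?thesis
    using hs_norm_unitary_left[OF unitary_matrices_adjoint[OF assms(1)] mat_adjoint_carrier[OF assms(2)]]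
      hs_norm_adjoint[OF assms(2)] by simp
qed

lemma hs_norm_one: "0 < n \<Longrightarrow> hs_norm n (1\<^sub>m n) = 1"
proof -
  have "mat_trace (1\<^sub>m n) = of_nat n" by (simp add: mat_trace_def)
  then show "0 < n \<Longrightarrow> ?thesis" by (simp add: hs_norm_def)
qed

lemma hs_norm_smult: "A \<in> carrier_mat n n \<Longrightarrow> hs_norm n (c \<cdot>\<^sub>m A) = cmod c * hs_norm n A"
proof -
  assume A: "A \<in> carrier_mat n n"
  have "frobenius (c \<cdot>\<^sub>m A) = L2_set (\<lambda>p. cmod c * cmod (A $$ p)) ({..<n} \<times> {..<n})"
    using A by (auto simp: frobenius_def norm_mult intro!: L2_set_cong)
  also have "\<dots> = cmod c * frobenius A"
    using A by (simp add: frobenius_def L2_set_right_distrib)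
  finally show ?thesis using A by (simp add: hs_norm_frobenius)
qed

lemma hs_norm_sum:
  assumes "finite M" "\<And>x. x \<in> M \<Longrightarrow> f x \<in> carrier_mat n n"
  shows "hs_norm n (mat_sum n n f M) \<le> (\<Sum>x\<in>M. hs_norm n (f x))"
  using assms
proof (induction M)
  case empty
  show ?case by (simp add: hs_norm_zero)
next
  case (insert x M)
  then show ?case
    using hs_norm_triangle[of "f x" n "mat_sum n n f M"] by (simp add: mat_sum_insert)
qed

text \<open>Each of the \<open>n\<close> columns \<open>A e\<^sub>j\<close> has Euclidean norm at most \<open>c\<close>.\<close>

lemma hs_norm_le_op_bound:
  assumes A: "A \<in> carrier_mat n n" and c: "op_bound A c" "0 \<le> c"
  shows "hs_norm n A \<le> c"
proof -
  have "(frobenius A)\<^sup>2 = (\<Sum>j<n. \<Sum>i<n. (cmod (A $$ (i, j)))\<^sup>2)"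
    unfolding frobenius_sq using A sum.swap[of "\<lambda>i j. (cmod (A $$ (i, j)))\<^sup>2" "{..<n}" "{..<n}"] by simp
  also have "\<dots> \<le> (\<Sum>j<n. c\<^sup>2)"
  proof (rule sum_mono)
    fix j assume "j \<in> {..<n}"
    then have j: "j < n" by simp
    have "(A *\<^sub>v unit_vec n j) $ i = A $$ (i, j)" if "i < n" for i
      using A j that by (simp add: mat_of_rows_def)
    then have "(\<Sum>i<n. (cmod (A $$ (i, j)))\<^sup>2) = (euclidean_norm_vec (A *\<^sub>v unit_vec n j))\<^sup>2"
      using A by (simp add: euclidean_norm_vec_def sum_nonneg del: index_mult_mat_vec)
    also have "\<dots> \<le> c\<^sup>2"
      using op_boundD[OF c(1) A, of "unit_vec n j"] j by (intro power_mono) (auto simp: euclidean_norm_vec_unit)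
    finally show "(\<Sum>i<n. (cmod (A $$ (i, j)))\<^sup>2) \<le> c\<^sup>2" .
  qed
  also have "\<dots> = (sqrt n * c)\<^sup>2" by (simp add: power_mult_distrib)
  finally have "frobenius A \<le> sqrt n * c" using c(2) by (simp add: power2_le_iff_abs_le)
  then show ?thesis
    using c(2) A by (cases "n = 0") (auto simp: hs_norm_frobenius field_simps)
qed

lemma asymp_eq_hs_norm:
  assumes "asymp_eq d d X Y"
  shows "(\<lambda>n. hs_norm (d n) (X n - Y n)) \<longlonglongrightarrow> 0"
proof (rule tendstoI)
  fix r :: real assume r: "r > 0"
  then have "\<forall>\<^sub>F n in sequentially. op_bound (X n - Y n) (r / 2)"
    by (intro asymp_eqD[OF assms]) simp
  then show "\<forall>\<^sub>F n in sequentially. dist (hs_norm (d n) (X n - Y n)) 0 < r"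
  proof eventually_elim
    case (elim n)
    have XY: "X n - Y n \<in> carrier_mat (d n) (d n)"
      using minus_carrier_mat[OF bounded_seqD[OF asymp_eq_bounded(2)[OF assms]]] .
    show ?case
      using hs_norm_le_op_bound[OF XY elim] hs_norm_nonneg[OF XY] r by (simp add: dist_real_def)
  qed
qed

section \<open>Separation in the Hilbert--Schmidt norm\<close>

definition hs_separates :: "(nat \<Rightarrow> nat) \<Rightarrow> (nat \<Rightarrow> 'a \<Rightarrow> complex mat) \<Rightarrow> 'a \<Rightarrow> bool" where
  "hs_separates d \<phi> g \<longleftrightarrow> (\<exists>c>0. \<forall>\<^sub>F n in sequentially. c \<le> hs_norm (d n) (\<phi> n g - 1\<^sub>m (d n)))"

text \<open>
  Used with \<open>D n\<close> the distance of \<open>\<phi>(h)\<close> from \<open>1\<close>: where \<open>D\<close> is small, a dominated sequence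
  is small.
\<close>

definition dominated :: "(nat \<Rightarrow> real) \<Rightarrow> (nat \<Rightarrow> real) \<Rightarrow> bool" where
  "dominated D f \<longleftrightarrow> (\<exists>C s. 0 \<le> C \<and> s \<longlonglongrightarrow> 0 \<and> (\<forall>n. f n \<le> C * D n + s n))"

lemma dominated_self: "dominated D D"
  unfolding dominated_def by (intro exI[of _ 1] exI[of _ "\<lambda>_. 0"]) auto

lemma dominated_null: "s \<longlonglongrightarrow> 0 \<Longrightarrow> dominated D s"
  unfolding dominated_def by (intro exI[of _ 0] exI[of _ s]) auto

lemma dominated_mono: "dominated D f \<Longrightarrow> (\<And>n. g n \<le> f n) \<Longrightarrow> dominated D g"
  unfolding dominated_def by (meson order_trans)

lemma dominated_add:
  assumes "dominated D f" "dominated D g"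
  shows "dominated D (\<lambda>n. f n + g n)"
proof -
  from assms obtain C s C' s' where *: "0 \<le> C" "s \<longlonglongrightarrow> 0" "\<And>n. f n \<le> C * D n + s n"
    "0 \<le> C'" "s' \<longlonglongrightarrow> 0" "\<And>n. g n \<le> C' * D n + s' n"
    by (auto simp: dominated_def)
  have "f n + g n \<le> (C + C') * D n + (s n + s' n)" for n
    using *(3,6)[of n] by (simp add: algebra_simps)
  moreover have "(\<lambda>n. s n + s' n) \<longlonglongrightarrow> 0" using tendsto_add[OF *(2,5)] by simp
  ultimately show ?thesis using *(1,4) unfolding dominated_def
    by (intro exI[of _ "C + C'"] exI[of _ "\<lambda>n. s n + s' n"]) auto
qed

lemma dominated_sum:
  "finite M \<Longrightarrow> (\<And>x. x \<in> M \<Longrightarrow> dominated D (f x)) \<Longrightarrow> dominated D (\<lambda>n. \<Sum>x\<in>M. f x n)"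
  by (induction M rule: finite_induct) (auto intro: dominated_add dominated_null)

text \<open>
  The distance from \<open>1\<close> is subadditive on products and invariant under inverses and
  conjugation, up to errors that tend to \<open>0\<close>, because the norm is unitarily invariant.
\<close>

lemma (in op_asymptotic_rep) dominated_normal_subgroup:
  shows "{x \<in> carrier G. dominated D (\<lambda>n. hs_norm (d n) (\<phi> n x - 1\<^sub>m (d n)))} \<lhd> G" (is "?K \<lhd> G")
proof -
  let ?f = "\<lambda>x n. hs_norm (d n) (\<phi> n x - 1\<^sub>m (d n))"
  have step: "dominated D (?f x)" if x: "x \<in> carrier G" and X: "asymp_eq d d (\<lambda>n. \<phi> n x) X"
    and d: "dominated D (\<lambda>n. hs_norm (d n) (X n - 1\<^sub>m (d n)))" for x X
  proof (rule dominated_mono[OF dominated_add[OF dominated_null[OF asymp_eq_hs_norm[OF X]] d]])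
    show "?f x n \<le> hs_norm (d n) (\<phi> n x - X n) + hs_norm (d n) (X n - 1\<^sub>m (d n))" for n
      using bounded_seqD[OF asymp_eq_bounded(2)[OF X]] x by (intro hs_norm_diff_triangle) auto
  qed
  have zero: "hs_norm (d n) (1\<^sub>m (d n) - 1\<^sub>m (d n)) = 0" for n
  proof -
    have "1\<^sub>m (d n) - 1\<^sub>m (d n) = (0\<^sub>m (d n) (d n) :: complex mat)" by (rule minus_r_inv_mat[OF one_carrier_mat])
    then show ?thesis by (simp only: hs_norm_zero)
  qed
  have one_K: "\<one> \<in> ?K"
    using step[OF one_closed one] by (simp add: zero dominated_null)
  have mult_K: "x \<otimes> y \<in> ?K" if x: "x \<in> ?K" and y: "y \<in> ?K" for x y
  proof -
    from x y have c: "x \<in> carrier G" "y \<in> carrier G" and D: "dominated D (?f x)" "dominated D (?f y)" by auto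
    have "hs_norm (d n) (\<phi> n x * \<phi> n y - 1\<^sub>m (d n)) \<le> ?f y n + ?f x n" for n
    proof -
      note X = dims[OF c(1), of n] and Y = dims[OF c(2), of n]
      have "hs_norm (d n) (\<phi> n x * \<phi> n y - 1\<^sub>m (d n)) \<le>
          hs_norm (d n) (\<phi> n x * \<phi> n y - \<phi> n x) + ?f x n"
        using mult_carrier_mat[OF X Y] X by (intro hs_norm_diff_triangle) auto
      also have "\<phi> n x * \<phi> n y - \<phi> n x = \<phi> n x * (\<phi> n y - 1\<^sub>m (d n))"
        using mult_minus_distrib_mat[OF X Y one_carrier_mat] by (simp add: right_mult_one_mat[OF X])
      also have "hs_norm (d n) \<dots> = ?f y n"
        by (rule hs_norm_unitary_left[OF unitary[OF c(1)] minus_carrier_mat[OF one_carrier_mat]])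
      finally show ?thesis .
    qed
    then have "dominated D (\<lambda>n. hs_norm (d n) (\<phi> n x * \<phi> n y - 1\<^sub>m (d n)))"
      by (rule dominated_mono[OF dominated_add[OF D(2,1)]])
    then show ?thesis using step[OF _ mult[OF c]] c by simp
  qed
  have inv_K: "inv x \<in> ?K" if x: "x \<in> ?K" for x
  proof -
    from x have c: "x \<in> carrier G" and D: "dominated D (?f x)" by auto
    have "hs_norm (d n) (mat_adjoint (\<phi> n x) - 1\<^sub>m (d n)) = ?f x n" for n
      using hs_norm_adjoint[OF minus_carrier_mat[OF one_carrier_mat], of "d n" "\<phi> n x"]
      by (simp add: mat_adjoint_diff[OF dims[OF c] one_carrier_mat])
    then show ?thesis using step[OF _ inverse[OF c]] c D by simp
  qed
  have conj_K: "g \<otimes> x \<otimes> inv g \<in> ?K" if g: "g \<in> carrier G" and x: "x \<in> ?K" for g x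
  proof -
    from x have c: "x \<in> carrier G" and D: "dominated D (?f x)" by auto
    have "asymp_eq d d (\<lambda>n. \<phi> n (g \<otimes> x \<otimes> inv g)) (\<lambda>n. \<phi> n (g \<otimes> x) * \<phi> n (inv g))"
      using g c by (intro mult) auto
    also have "asymp_eq d d \<dots> (\<lambda>n. \<phi> n g * \<phi> n x * mat_adjoint (\<phi> n g))"
      by (rule asymp_eq_mult[OF mult[OF g c] inverse[OF g]])
    finally have conj: "asymp_eq d d (\<lambda>n. \<phi> n (g \<otimes> x \<otimes> inv g)) (\<lambda>n. \<phi> n g * \<phi> n x * mat_adjoint (\<phi> n g))" .
    have "hs_norm (d n) (\<phi> n g * \<phi> n x * mat_adjoint (\<phi> n g) - 1\<^sub>m (d n)) = ?f x n" for n
    proof -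
      note X = dims[OF c, of n] and U = unitary[OF g, of n]
      note U' = unitary_matricesD[OF U]
      have "\<phi> n g * \<phi> n x * mat_adjoint (\<phi> n g) - 1\<^sub>m (d n) =
          \<phi> n g * \<phi> n x * mat_adjoint (\<phi> n g) - \<phi> n g * mat_adjoint (\<phi> n g)"
        using U' by simp
      also have "\<dots> = (\<phi> n g * \<phi> n x - \<phi> n g) * mat_adjoint (\<phi> n g)"
        by (rule minus_mult_distrib_mat[OF mult_carrier_mat[OF U'(1) X] U'(1) mat_adjoint_carrier[OF U'(1)], symmetric])
      also have "\<phi> n g * \<phi> n x - \<phi> n g = \<phi> n g * (\<phi> n x - 1\<^sub>m (d n))"
        using mult_minus_distrib_mat[OF U'(1) X one_carrier_mat] by (simp add: right_mult_one_mat[OF U'(1)])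
      finally have "\<phi> n g * \<phi> n x * mat_adjoint (\<phi> n g) - 1\<^sub>m (d n) =
          \<phi> n g * (\<phi> n x - 1\<^sub>m (d n)) * mat_adjoint (\<phi> n g)" .
      moreover have c1: "\<phi> n x - 1\<^sub>m (d n) \<in> carrier_mat (d n) (d n)"
        by (rule minus_carrier_mat[OF one_carrier_mat])
      ultimately show ?thesis
        using hs_norm_unitary_right[OF unitary_matrices_adjoint[OF U] mult_carrier_mat[OF U'(1) c1]]
          hs_norm_unitary_left[OF U c1] by simp
    qed
    then show ?thesis using step[OF _ conj] g c D by simp
  qed
  have "subgroup ?K G"
    using one_K mult_K inv_K by (intro subgroupI) auto
  then show ?thesis using conj_K by (simp add: normal_inv_iff)
qed

text \<open>
  If \<open>\<phi>(h)\<close> were close to \<open>1\<close> in the normalized Hilbert--Schmidt norm, so would be all \<open>\<phi>(x)\<close>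
  with \<open>x \<in> M\<close>, since the elements with this property form a normal subgroup containing \<open>h\<close>. Then
  the sum of the \<open>\<phi>(x)\<close> would be close to \<open>|M|\<close> times the identity, which has norm \<open>|M| \<ge> 1\<close>,
  whereas this sum tends to \<open>0\<close>.
\<close>

lemma (in op_asymptotic_rep) hs_separates_normal_generator:
  assumes fin: "finite M" and M: "M \<subseteq> carrier G" "M \<noteq> {}" and h: "h \<in> carrier G"
    and least: "\<And>K. K \<lhd> G \<Longrightarrow> h \<in> K \<Longrightarrow> M \<subseteq> K"
    and sum_zero: "asymp_eq d d (\<lambda>n. mat_sum (d n) (d n) (\<phi> n) M) (\<lambda>n. 0\<^sub>m (d n) (d n))"
    and d: "\<forall>\<^sub>F n in sequentially. d n \<noteq> 0"
  shows "hs_separates d \<phi> h"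
proof -
  define f where "f x n = hs_norm (d n) (\<phi> n x - 1\<^sub>m (d n))" for x n
  have dom: "dominated (f h) (f x)" if "x \<in> M" for x
    using least[OF dominated_normal_subgroup[of "f h"]] h that dominated_self[of "f h"] unfolding f_def by blast
  define S where "S n = hs_norm (d n) (mat_sum (d n) (d n) (\<phi> n) M)" for n
  have "S \<longlonglongrightarrow> 0"
  proof -
    have "mat_sum (d n) (d n) (\<phi> n) M - 0\<^sub>m (d n) (d n) = mat_sum (d n) (d n) (\<phi> n) M" for n
      by (intro eq_matI) (auto simp: mat_sum_def)
    then show ?thesis using asymp_eq_hs_norm[OF sum_zero] by (simp add: S_def[abs_def])
  qed
  from dominated_add[OF dominated_null[OF this] dominated_sum[OF fin, of "f h" f, OF dom]]
  obtain C s where C: "0 \<le> C" "s \<longlonglongrightarrow> 0" "\<And>n. S n + (\<Sum>x\<in>M. f x n) \<le> C * f h n + s n"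
    by (auto simp: dominated_def)
  have cardM: "card M \<ge> 1" using fin M(2) by (simp add: Suc_le_eq card_gt_0_iff)
  have lower: "1 \<le> S n + (\<Sum>x\<in>M. f x n)" if "d n \<noteq> 0" for n
  proof -
    let ?m = "mat_sum (d n) (d n)"
    have c: "\<phi> n x - 1\<^sub>m (d n) \<in> carrier_mat (d n) (d n)" for x by (rule minus_carrier_mat[OF one_carrier_mat])
    have "real (card M) = hs_norm (d n) (of_nat (card M) \<cdot>\<^sub>m 1\<^sub>m (d n))"
      using that by (simp add: hs_norm_smult[OF one_carrier_mat] hs_norm_one)
    also have "of_nat (card M) \<cdot>\<^sub>m 1\<^sub>m (d n) = ?m (\<lambda>_. 1\<^sub>m (d n)) M"
      by (simp add: mat_sum_const[OF one_carrier_mat])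
    also have "\<dots> = ?m (\<phi> n) M - ?m (\<lambda>x. \<phi> n x - 1\<^sub>m (d n)) M"
    proof -
      have "x \<in> M \<Longrightarrow> dim_row (\<phi> n x) = d n \<and> dim_col (\<phi> n x) = d n" for x
        using carrier_matD[OF dims, of x n] M(1) by blast
      then show ?thesis by (intro eq_matI) (auto simp: mat_sum_def sum_subtractf)
    qed
    also have "\<dots> = ?m (\<phi> n) M + (-1) \<cdot>\<^sub>m ?m (\<lambda>x. \<phi> n x - 1\<^sub>m (d n)) M"
      by (rule minus_mat_eq_add_smult[OF mat_sum_carrier mat_sum_carrier])
    also have "hs_norm (d n) \<dots> \<le> S n + hs_norm (d n) ((-1) \<cdot>\<^sub>m ?m (\<lambda>x. \<phi> n x - 1\<^sub>m (d n)) M)"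
      unfolding S_def by (rule hs_norm_triangle[OF mat_sum_carrier smult_carrier_mat[OF mat_sum_carrier]])
    also have "hs_norm (d n) ((-1) \<cdot>\<^sub>m ?m (\<lambda>x. \<phi> n x - 1\<^sub>m (d n)) M) \<le> (\<Sum>x\<in>M. f x n)"
      using hs_norm_sum[OF fin c] by (simp add: hs_norm_smult[OF mat_sum_carrier] f_def)
    finally show ?thesis using cardM by simp
  qed
  have "\<forall>\<^sub>F n in sequentially. s n < 1/2" by (rule order_tendstoD(2)[OF C(2)]) simp
  then have "\<forall>\<^sub>F n in sequentially. 1 / (2 * (C + 1)) \<le> f h n"
    using d
  proof eventually_elim
    case (elim n)
    have "f h n \<ge> 0" unfolding f_def by (intro hs_norm_nonneg minus_carrier_mat one_carrier_mat)
    moreover have "C * f h n \<ge> 1/2" using lower[OF elim(2)] C(3)[of n] elim(1) by linarith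
    ultimately show ?case using C(1) by (simp add: field_simps)
  qed
  then show ?thesis
    unfolding hs_separates_def f_def using C(1) by (intro exI[of _ "1 / (2 * (C + 1))"]) auto
qed

section \<open>Direct sums and amplification\<close>

definition hs_asymptotic_rep ::
    "('a, 'b) monoid_scheme \<Rightarrow> (nat \<Rightarrow> nat) \<Rightarrow> (nat \<Rightarrow> 'a \<Rightarrow> complex mat) \<Rightarrow> bool" where
  "hs_asymptotic_rep G d \<phi> \<longleftrightarrow>
     (\<forall>n. \<forall>g\<in>carrier G. \<phi> n g \<in> unitary_matrices (d n)) \<and>
     (\<forall>g\<in>carrier G. \<forall>h\<in>carrier G.
        (\<lambda>n. hs_norm (d n) (\<phi> n (g \<otimes>\<^bsub>G\<^esub> h) - \<phi> n g * \<phi> n h)) \<longlonglongrightarrow> 0)"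

lemma hs_asymptotic_repD:
  assumes "hs_asymptotic_rep G d \<phi>"
  shows "g \<in> carrier G \<Longrightarrow> \<phi> n g \<in> unitary_matrices (d n)"
    and "g \<in> carrier G \<Longrightarrow> h \<in> carrier G \<Longrightarrow>
      (\<lambda>n. hs_norm (d n) (\<phi> n (g \<otimes>\<^bsub>G\<^esub> h) - \<phi> n g * \<phi> n h)) \<longlonglongrightarrow> 0"
  using assms by (auto simp: hs_asymptotic_rep_def)

lemma (in op_asymptotic_rep) hs_asymptotic_rep: "hs_asymptotic_rep G d \<phi>"
  using unitary mult by (auto simp: hs_asymptotic_rep_def intro: asymp_eq_hs_norm)

lemma hs_norm_sq:
  assumes "A \<in> carrier_mat n n"
  shows "real n * (hs_norm n A)\<^sup>2 = (frobenius A)\<^sup>2"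
proof (cases "n = 0")
  case True
  then have "(frobenius A)\<^sup>2 = 0" unfolding frobenius_sq using assms by simp
  then show ?thesis using True by simp
qed (use assms in \<open>simp add: hs_norm_frobenius power_divide\<close>)

definition direct_sum :: "complex mat \<Rightarrow> complex mat \<Rightarrow> complex mat" where
  "direct_sum A D = four_block_mat A (0\<^sub>m (dim_row A) (dim_col D)) (0\<^sub>m (dim_row D) (dim_col A)) D"

lemma direct_sum_carrier:
  "A \<in> carrier_mat a a \<Longrightarrow> D \<in> carrier_mat d d \<Longrightarrow> direct_sum A D \<in> carrier_mat (a + d) (a + d)"
  by (auto simp: direct_sum_def)

lemma direct_sum_one: "direct_sum (1\<^sub>m a) (1\<^sub>m d) = 1\<^sub>m (a + d)"
  by (simp add: direct_sum_def)

lemma direct_sum_mult: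
  assumes "A \<in> carrier_mat a a" "D \<in> carrier_mat d d" "A' \<in> carrier_mat a a" "D' \<in> carrier_mat d d"
  shows "direct_sum A D * direct_sum A' D' = direct_sum (A * A') (D * D')"
  using four_block_diag_mult[OF assms] assms by (simp add: direct_sum_def)

lemma direct_sum_adjoint:
  assumes "A \<in> carrier_mat a a" "D \<in> carrier_mat d d"
  shows "mat_adjoint (direct_sum A D) = direct_sum (mat_adjoint A) (mat_adjoint D)"
  using assms by (simp add: direct_sum_def mat_adjoint_four_block[of _ a a _ d _ d])

lemma direct_sum_diff:
  assumes "A \<in> carrier_mat a a" "D \<in> carrier_mat d d" "A' \<in> carrier_mat a a" "D' \<in> carrier_mat d d"
  shows "direct_sum A D - direct_sum A' D' = direct_sum (A - A') (D - D')"
  using assms by (intro eq_matI) (auto simp: direct_sum_def)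

lemma direct_sum_unitary:
  assumes "A \<in> unitary_matrices a" "D \<in> unitary_matrices d"
  shows "direct_sum A D \<in> unitary_matrices (a + d)"
proof (rule unitary_matricesI)
  note A = unitary_matricesD[OF assms(1)] and D = unitary_matricesD[OF assms(2)]
  show "direct_sum A D \<in> carrier_mat (a + d) (a + d)" using A D by (intro direct_sum_carrier)
  show "mat_adjoint (direct_sum A D) * direct_sum A D = 1\<^sub>m (a + d)"
    unfolding direct_sum_adjoint[OF A(1) D(1)]
      direct_sum_mult[OF mat_adjoint_carrier[OF A(1)] mat_adjoint_carrier[OF D(1)] A(1) D(1)] A(2) D(2)
    by (rule direct_sum_one)
qed

lemma frobenius_direct_sum:
  assumes "A \<in> carrier_mat a a" "D \<in> carrier_mat d d"
  shows "(frobenius (direct_sum A D))\<^sup>2 = (frobenius A)\<^sup>2 + (frobenius D)\<^sup>2"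
proof -
  have split: "(\<Sum>i<a + d. f i) = (\<Sum>i<a. f i) + (\<Sum>i<d. f (a + i))" for f :: "nat \<Rightarrow> real"
    by (induction d) auto
  show ?thesis using assms by (simp add: frobenius_sq direct_sum_def split)
qed

lemma hs_norm_direct_sum:
  assumes "A \<in> carrier_mat a a" "D \<in> carrier_mat d d"
  shows "real (a + d) * (hs_norm (a + d) (direct_sum A D))\<^sup>2 =
    real a * (hs_norm a A)\<^sup>2 + real d * (hs_norm d D)\<^sup>2"
  by (simp only: hs_norm_sq[OF direct_sum_carrier[OF assms]] hs_norm_sq[OF assms(1)] hs_norm_sq[OF assms(2)]
      frobenius_direct_sum[OF assms])

text \<open>
  The identity block pads the copies of \<open>A\<close> to a prescribed dimension.
\<close>

primrec amplify :: "nat \<Rightarrow> nat \<Rightarrow> complex mat \<Rightarrow> complex mat" where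
  "amplify 0 r A = 1\<^sub>m r"
| "amplify (Suc k) r A = direct_sum A (amplify k r A)"

lemma amplify_carrier: "A \<in> carrier_mat d d \<Longrightarrow> amplify k r A \<in> carrier_mat (k * d + r) (k * d + r)"
proof (induction k)
  case (Suc k)
  then show ?case using direct_sum_carrier[of A d "amplify k r A" "k * d + r"] by (simp add: add.assoc)
qed simp

lemma amplify_unitary: "A \<in> unitary_matrices d \<Longrightarrow> amplify k r A \<in> unitary_matrices (k * d + r)"
proof (induction k)
  case (Suc k)
  then show ?case using direct_sum_unitary[of A d "amplify k r A" "k * d + r"] by (simp add: add.assoc)
qed (simp add: unitary_matrices_one)

lemma amplify_mult:
  assumes "A \<in> carrier_mat d d" "B \<in> carrier_mat d d"
  shows "amplify k r A * amplify k r B = amplify k r (A * B)"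
  using direct_sum_mult[OF assms(1) amplify_carrier[OF assms(1)] assms(2) amplify_carrier[OF assms(2)]]
  by (induction k) auto

lemma amplify_one: "amplify k r (1\<^sub>m d) = 1\<^sub>m (k * d + r)"
  by (induction k) (simp_all add: direct_sum_one add.assoc)

lemma frobenius_amplify_diff:
  assumes "A \<in> carrier_mat d d" "B \<in> carrier_mat d d"
  shows "(frobenius (amplify k r A - amplify k r B))\<^sup>2 = real k * (frobenius (A - B))\<^sup>2"
proof (induction k)
  case 0
  have "1\<^sub>m r - 1\<^sub>m r = (0\<^sub>m r r :: complex mat)" by (rule minus_r_inv_mat[OF one_carrier_mat])
  then show ?case unfolding amplify.simps frobenius_sq by simp
next
  case (Suc k)
  note c = amplify_carrier[OF assms(1), of k r] amplify_carrier[OF assms(2), of k r]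
  show ?case
    using Suc frobenius_direct_sum[OF minus_carrier_mat[OF assms(2), of A] minus_carrier_mat[OF c(2), of "amplify k r A"]]
    by (simp add: direct_sum_diff[OF assms(1) c(1) assms(2) c(2)] algebra_simps)
qed

lemma hs_norm_amplify_diff:
  assumes "A \<in> carrier_mat d d" "B \<in> carrier_mat d d"
  shows "real (k * d + r) * (hs_norm (k * d + r) (amplify k r A - amplify k r B))\<^sup>2 =
    real (k * d) * (hs_norm d (A - B))\<^sup>2"
proof -
  have "real (k * d) * (hs_norm d (A - B))\<^sup>2 = real k * (frobenius (A - B))\<^sup>2"
    using hs_norm_sq[OF minus_carrier_mat[OF assms(2)], of A] by simp
  then show ?thesis
    by (simp only: hs_norm_sq[OF minus_carrier_mat[OF amplify_carrier[OF assms(2)]]] frobenius_amplify_diff[OF assms])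
qed

text \<open>
  A block of size \<open>0 < d \<le> n\<close> fits \<open>n div d\<close> times into dimension \<open>n\<close>, and its copies fill at
  least half of it, so the normalized distance from \<open>1\<close> loses at most a constant factor.
\<close>

lemma hs_amplification:
  assumes \<phi>: "hs_asymptotic_rep G d \<phi>" and d: "\<And>n. d n \<le> n" and G: "group G"
  obtains \<chi> where "hs_asymptotic_rep G (\<lambda>n. n) \<chi>"
    "\<And>g. g \<in> carrier G \<Longrightarrow> \<forall>\<^sub>F n in sequentially. d n \<noteq> 0 \<Longrightarrow> hs_separates d \<phi> g \<Longrightarrow> hs_separates (\<lambda>n. n) \<chi> g"
proof -
  interpret group G by (rule G)
  note u = hs_asymptotic_repD(1)[OF \<phi>]
  note c = unitary_matricesD(1)[OF u]
  define \<chi> where "\<chi> n g = amplify (n div d n) (n mod d n) (\<phi> n g)" for n g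
  have size: "n div d n * d n + n mod d n = n" for n by simp
  have hs: "real n * (hs_norm n (amplify (n div d n) (n mod d n) A - amplify (n div d n) (n mod d n) B))\<^sup>2 =
      real (n div d n * d n) * (hs_norm (d n) (A - B))\<^sup>2"
    if "A \<in> carrier_mat (d n) (d n)" "B \<in> carrier_mat (d n) (d n)" for n A B
    using hs_norm_amplify_diff[OF that, of "n div d n" "n mod d n"] by (simp only: size)
  have "hs_asymptotic_rep G (\<lambda>n. n) \<chi>"
    unfolding hs_asymptotic_rep_def
  proof (intro conjI allI ballI)
    fix n g assume "g \<in> carrier G"
    then show "\<chi> n g \<in> unitary_matrices n"
      unfolding \<chi>_def using amplify_unitary[of "\<phi> n g" "d n" "n div d n" "n mod d n", OF u] by (simp only: size)
  next
    fix g h assume g: "g \<in> carrier G" and h: "h \<in> carrier G"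
    let ?X = "\<lambda>n. \<phi> n (g \<otimes>\<^bsub>G\<^esub> h) - \<phi> n g * \<phi> n h"
    let ?Y = "\<lambda>n. \<chi> n (g \<otimes>\<^bsub>G\<^esub> h) - \<chi> n g * \<chi> n h"
    show "(\<lambda>n. hs_norm n (?Y n)) \<longlonglongrightarrow> 0"
    proof (rule tendsto_sandwich[OF _ _ tendsto_const hs_asymptotic_repD(2)[OF \<phi> g h]])
      have Yc: "?Y n \<in> carrier_mat n n" for n
      proof -
        have "\<chi> n x \<in> carrier_mat n n" if "x \<in> carrier G" for x
          unfolding \<chi>_def using amplify_carrier[OF c[OF that], of "n div d n" "n mod d n" n] by (simp only: size)
        then show ?thesis using g h by (intro minus_carrier_mat mult_carrier_mat)
      qed
      show "\<forall>\<^sub>F n in sequentially. 0 \<le> hs_norm n (?Y n)" using hs_norm_nonneg[OF Yc] by simp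
      show "\<forall>\<^sub>F n in sequentially. hs_norm n (?Y n) \<le> hs_norm (d n) (?X n)"
        using eventually_gt_at_top[of 0]
      proof eventually_elim
        case (elim n)
        have X: "\<phi> n (g \<otimes>\<^bsub>G\<^esub> h) \<in> carrier_mat (d n) (d n)" "\<phi> n g * \<phi> n h \<in> carrier_mat (d n) (d n)"
          using c g h by (auto intro!: mult_carrier_mat)
        have "real n * (hs_norm n (?Y n))\<^sup>2 = real (n div d n * d n) * (hs_norm (d n) (?X n))\<^sup>2"
          using hs[OF X] by (simp add: \<chi>_def amplify_mult[OF c[OF g] c[OF h]])
        also have "\<dots> \<le> real n * (hs_norm (d n) (?X n))\<^sup>2"
          by (intro mult_right_mono) (simp_all del: of_nat_mult add: div_times_less_eq_dividend)
        finally have "(hs_norm n (?Y n))\<^sup>2 \<le> (hs_norm (d n) (?X n))\<^sup>2" using elim by simp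
        then show ?case
          by (rule power2_le_imp_le) (rule hs_norm_nonneg[OF minus_carrier_mat[OF X(2)]])
      qed
    qed
  qed
  moreover have "hs_separates (\<lambda>n. n) \<chi> g"
    if g: "g \<in> carrier G" and d0: "\<forall>\<^sub>F n in sequentially. d n \<noteq> 0" and sep: "hs_separates d \<phi> g" for g
  proof -
    from sep obtain r where r: "r > 0" "\<forall>\<^sub>F n in sequentially. r \<le> hs_norm (d n) (\<phi> n g - 1\<^sub>m (d n))"
      by (auto simp: hs_separates_def)
    from r(2) d0 have "\<forall>\<^sub>F n in sequentially. r / 2 \<le> hs_norm n (\<chi> n g - 1\<^sub>m n)"
    proof eventually_elim
      case (elim n)
      let ?x = "hs_norm (d n) (\<phi> n g - 1\<^sub>m (d n))" and ?y = "hs_norm n (\<chi> n g - 1\<^sub>m n)"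
      have "n mod d n < d n" using elim by simp
      also have "d n \<le> n div d n * d n" using elim d[of n] by (simp add: Suc_le_eq div_greater_zero_iff)
      finally have "n \<le> 2 * (n div d n * d n)" using size[of n] by linarith
      then have k: "real n \<le> 2 * real (n div d n * d n)" by linarith
      have "1\<^sub>m n = amplify (n div d n) (n mod d n) (1\<^sub>m (d n))" by (simp only: amplify_one size)
      then have eq: "real n * ?y\<^sup>2 = real (n div d n * d n) * ?x\<^sup>2"
        using hs[OF c[OF g] one_carrier_mat] by (simp add: \<chi>_def)
      have n: "n > 0" using elim d[of n] by simp
      have "real n * ?x\<^sup>2 \<le> 2 * real (n div d n * d n) * ?x\<^sup>2" using k by (intro mult_right_mono) auto
      also have "\<dots> = real n * (2 * ?y\<^sup>2)" using eq by simp
      finally have "?x\<^sup>2 \<le> 2 * ?y\<^sup>2" using n by simp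
      moreover have "(2 * ?y)\<^sup>2 = 2 * ?y\<^sup>2 + 2 * ?y\<^sup>2" by (simp add: power_mult_distrib)
      ultimately have "?x\<^sup>2 \<le> (2 * ?y)\<^sup>2" using zero_le_power2[of ?y] by linarith
      then have "?x \<le> 2 * ?y"
        by (rule power2_le_imp_le) (simp add: hs_norm_nonneg minus_carrier_mat)
      then show ?case using elim by simp
    qed
    then show ?thesis unfolding hs_separates_def using r(1) by (intro exI[of _ "r / 2"]) auto
  qed
  ultimately show ?thesis using that by blast
qed

text \<open>
  Each summand fills about half of the dimension, which again costs only a constant factor.
\<close>

lemma hs_direct_sum:
  assumes \<phi>: "hs_asymptotic_rep G (\<lambda>n. n) \<phi>" and \<psi>: "hs_asymptotic_rep G (\<lambda>n. n) \<psi>" and G: "group G"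
  obtains \<chi> where "hs_asymptotic_rep G (\<lambda>n. n) \<chi>"
    "\<And>g. g \<in> carrier G \<Longrightarrow> hs_separates (\<lambda>n. n) \<phi> g \<or> hs_separates (\<lambda>n. n) \<psi> g \<Longrightarrow> hs_separates (\<lambda>n. n) \<chi> g"
proof -
  interpret group G by (rule G)
  define a b :: "nat \<Rightarrow> nat" where "a n = n div 2" and "b n = n - n div 2" for n
  have size: "a n + b n = n" for n by (auto simp: a_def b_def)
  have lim: "filterlim a at_top at_top" "filterlim b at_top at_top"
  proof -
    have "\<forall>n\<ge>2 * Z. Z \<le> n div 2" "\<forall>n\<ge>2 * Z. Z \<le> n - n div 2" for Z :: nat by auto
    then show "filterlim a at_top at_top" "filterlim b at_top at_top"
      unfolding filterlim_at_top eventually_at_top_linorder a_def b_def by blast+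
  qed
  note u\<phi> = hs_asymptotic_repD(1)[OF \<phi>] and u\<psi> = hs_asymptotic_repD(1)[OF \<psi>]
  note c\<phi> = unitary_matricesD(1)[OF u\<phi>] and c\<psi> = unitary_matricesD(1)[OF u\<psi>]
  have sum_sq: "x\<^sup>2 + y\<^sup>2 \<le> (x + y)\<^sup>2" if "0 \<le> x" "0 \<le> y" for x y :: real
    using that by (simp add: power2_sum)
  define \<chi> where "\<chi> n g = direct_sum (\<phi> (a n) g) (\<psi> (b n) g)" for n g
  have hs: "real n * (hs_norm n (direct_sum A D - direct_sum A' D'))\<^sup>2 =
      real (a n) * (hs_norm (a n) (A - A'))\<^sup>2 + real (b n) * (hs_norm (b n) (D - D'))\<^sup>2"
    if "A \<in> carrier_mat (a n) (a n)" "D \<in> carrier_mat (b n) (b n)"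
      "A' \<in> carrier_mat (a n) (a n)" "D' \<in> carrier_mat (b n) (b n)" for n A D A' D'
    using hs_norm_direct_sum[OF minus_carrier_mat[OF that(3)] minus_carrier_mat[OF that(4)], of A D]
    by (simp only: size direct_sum_diff[OF that])
  have \<chi>u: "\<chi> n g \<in> unitary_matrices n" if "g \<in> carrier G" for n g
    unfolding \<chi>_def using direct_sum_unitary[OF u\<phi>[OF that] u\<psi>[OF that], of "a n" "b n"] by (simp only: size)
  have "hs_asymptotic_rep G (\<lambda>n. n) \<chi>"
    unfolding hs_asymptotic_rep_def
  proof (intro conjI allI ballI)
    fix g h assume g: "g \<in> carrier G" and h: "h \<in> carrier G"
    let ?X = "\<lambda>n. hs_norm n (\<phi> n (g \<otimes>\<^bsub>G\<^esub> h) - \<phi> n g * \<phi> n h)"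
    let ?Y = "\<lambda>n. hs_norm n (\<psi> n (g \<otimes>\<^bsub>G\<^esub> h) - \<psi> n g * \<psi> n h)"
    let ?Z = "\<lambda>n. \<chi> n (g \<otimes>\<^bsub>G\<^esub> h) - \<chi> n g * \<chi> n h"
    have "(\<lambda>n. ?X (a n) + ?Y (b n)) \<longlonglongrightarrow> 0 + 0"
      using filterlim_compose[OF hs_asymptotic_repD(2)[OF \<phi> g h] lim(1)]
        filterlim_compose[OF hs_asymptotic_repD(2)[OF \<psi> g h] lim(2)] by (rule tendsto_add)
    then have upper: "(\<lambda>n. ?X (a n) + ?Y (b n)) \<longlonglongrightarrow> 0" by simp
    show "(\<lambda>n. hs_norm n (?Z n)) \<longlonglongrightarrow> 0"
    proof (rule tendsto_sandwich[OF _ _ tendsto_const upper])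
      have Zc: "?Z n \<in> carrier_mat n n" for n
        using \<chi>u g h by (intro minus_carrier_mat mult_carrier_mat) (auto intro: unitary_matricesD(1))
      show "\<forall>\<^sub>F n in sequentially. 0 \<le> hs_norm n (?Z n)" using hs_norm_nonneg[OF Zc] by simp
      show "\<forall>\<^sub>F n in sequentially. hs_norm n (?Z n) \<le> ?X (a n) + ?Y (b n)"
        using eventually_gt_at_top[of 0]
      proof eventually_elim
        case (elim n)
        have gh: "g \<otimes>\<^bsub>G\<^esub> h \<in> carrier G" using g h by simp
        have nonneg: "0 \<le> ?X (a n)" "0 \<le> ?Y (b n)"
          by (rule hs_norm_nonneg[OF minus_carrier_mat[OF mult_carrier_mat[OF c\<phi>[OF g] c\<phi>[OF h]]]],
            rule hs_norm_nonneg[OF minus_carrier_mat[OF mult_carrier_mat[OF c\<psi>[OF g] c\<psi>[OF h]]]])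
        have "\<chi> n g * \<chi> n h = direct_sum (\<phi> (a n) g * \<phi> (a n) h) (\<psi> (b n) g * \<psi> (b n) h)"
          unfolding \<chi>_def by (rule direct_sum_mult[OF c\<phi>[OF g] c\<psi>[OF g] c\<phi>[OF h] c\<psi>[OF h]])
        then have "real n * (hs_norm n (?Z n))\<^sup>2 = real (a n) * (?X (a n))\<^sup>2 + real (b n) * (?Y (b n))\<^sup>2"
          using hs[OF c\<phi>[OF gh] c\<psi>[OF gh] mult_carrier_mat[OF c\<phi>[OF g] c\<phi>[OF h]] mult_carrier_mat[OF c\<psi>[OF g] c\<psi>[OF h]]]
          by (simp add: \<chi>_def)
        also have "\<dots> \<le> real n * (?X (a n))\<^sup>2 + real n * (?Y (b n))\<^sup>2"
          by (intro add_mono mult_right_mono) (auto simp: a_def b_def)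
        also have "\<dots> = real n * ((?X (a n))\<^sup>2 + (?Y (b n))\<^sup>2)" by (rule distrib_left[symmetric])
        also have "\<dots> \<le> real n * (?X (a n) + ?Y (b n))\<^sup>2"
          by (rule mult_left_mono[OF sum_sq[OF nonneg]]) simp
        finally have "(hs_norm n (?Z n))\<^sup>2 \<le> (?X (a n) + ?Y (b n))\<^sup>2"
          by (rule mult_left_le_imp_le) (use elim in simp)
        then show ?case by (rule power2_le_imp_le[OF _ add_nonneg_nonneg[OF nonneg]])
      qed
    qed
  qed (rule \<chi>u)
  moreover have "hs_separates (\<lambda>n. n) \<chi> g"
    if g: "g \<in> carrier G" and sep: "hs_separates (\<lambda>n. n) \<phi> g \<or> hs_separates (\<lambda>n. n) \<psi> g" for g
  proof -
    let ?x = "\<lambda>n. hs_norm n (\<phi> n g - 1\<^sub>m n)" and ?y = "\<lambda>n. hs_norm n (\<psi> n g - 1\<^sub>m n)"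
    let ?z = "\<lambda>n. hs_norm n (\<chi> n g - 1\<^sub>m n)"
    have eq: "real n * (?z n)\<^sup>2 = real (a n) * (?x (a n))\<^sup>2 + real (b n) * (?y (b n))\<^sup>2" for n
    proof -
      have "1\<^sub>m n = direct_sum (1\<^sub>m (a n)) (1\<^sub>m (b n))" by (simp only: direct_sum_one size)
      then show ?thesis
        using hs[OF c\<phi>[OF g] c\<psi>[OF g] one_carrier_mat one_carrier_mat] by (simp add: \<chi>_def)
    qed
    have half: "t \<le> 2 * ?z n" if n: "n \<ge> 2" and t: "real k * t\<^sup>2 \<le> real n * (?z n)\<^sup>2" and k: "n \<le> 4 * k" for n t k
    proof -
      have "real n * t\<^sup>2 \<le> 4 * real k * t\<^sup>2" using k by (intro mult_right_mono) auto
      also have "\<dots> \<le> 4 * (real n * (?z n)\<^sup>2)" using t by simp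
      finally have "real n * t\<^sup>2 \<le> real n * (4 * (?z n)\<^sup>2)" by simp
      then have "t\<^sup>2 \<le> (2 * ?z n)\<^sup>2" using n by (simp add: power_mult_distrib)
      then show ?thesis by (rule power2_le_imp_le) (simp add: hs_norm_nonneg minus_carrier_mat)
    qed
    from sep obtain r where r: "r > 0" and ev: "(\<forall>\<^sub>F n in sequentially. r \<le> ?x n) \<or> (\<forall>\<^sub>F n in sequentially. r \<le> ?y n)"
      by (auto simp: hs_separates_def)
    from ev have "\<forall>\<^sub>F n in sequentially. r \<le> ?x (a n) \<or> r \<le> ?y (b n)"
    proof
      assume "\<forall>\<^sub>F n in sequentially. r \<le> ?x n"
      from eventually_compose_filterlim[OF this lim(1)] show ?thesis by (rule eventually_mono) (rule disjI1)
    next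
      assume "\<forall>\<^sub>F n in sequentially. r \<le> ?y n"
      from eventually_compose_filterlim[OF this lim(2)] show ?thesis by (rule eventually_mono) (rule disjI2)
    qed
    then have "\<forall>\<^sub>F n in sequentially. r / 2 \<le> ?z n"
      using eventually_ge_at_top[of 2]
    proof eventually_elim
      case (elim n)
      have "?x (a n) \<le> 2 * ?z n" using elim(2) by (intro half[where k = "a n"]) (auto simp: eq a_def)
      moreover have "?y (b n) \<le> 2 * ?z n" using elim(2) by (intro half[where k = "b n"]) (auto simp: eq b_def)
      ultimately show ?case using elim(1) by linarith
    qed
    then show ?thesis unfolding hs_separates_def using r by (intro exI[of _ "r / 2"]) auto
  qed
  ultimately show ?thesis using that by blast
qed

section \<open>Approximations and asymptotic representations\<close>

lemma liminf_pos_iff: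
  fixes f :: "nat \<Rightarrow> real"
  shows "liminf (\<lambda>n. ereal (f n)) > 0 \<longleftrightarrow> (\<exists>c>0. \<forall>\<^sub>F n in sequentially. c \<le> f n)"
proof
  assume "liminf (\<lambda>n. ereal (f n)) > 0"
  then obtain c where c: "0 < ereal c" "ereal c < liminf (\<lambda>n. ereal (f n))"
    using ereal_dense2 by blast
  from less_LiminfD[OF c(2)] have "\<forall>\<^sub>F n in sequentially. c \<le> f n"
    by eventually_elim simp
  then show "\<exists>c>0. \<forall>\<^sub>F n in sequentially. c \<le> f n" using c(1) by (intro exI[of _ c]) simp
next
  assume "\<exists>c>0. \<forall>\<^sub>F n in sequentially. c \<le> f n"
  then obtain c where c: "c > 0" "\<forall>\<^sub>F n in sequentially. c \<le> f n" by blast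
  have "0 < ereal c" using c(1) by simp
  also have "ereal c \<le> liminf (\<lambda>n. ereal (f n))"
    by (rule Liminf_bounded) (use c(2) in \<open>auto elim: eventually_mono\<close>)
  finally show "liminf (\<lambda>n. ereal (f n)) > 0" .
qed

text \<open>The value at index \<open>0\<close> is replaced, so that the maps take unitary values at every index.\<close>

lemma approximated_wrtE:
  assumes "approximated_wrt nrm G" "group G"
  obtains \<phi> where "\<And>n g. g \<in> carrier G \<Longrightarrow> \<phi> n g \<in> unitary_matrices n"
    "\<And>g h. g \<in> carrier G \<Longrightarrow> h \<in> carrier G \<Longrightarrow> (\<lambda>n. nrm n (\<phi> n (g \<otimes>\<^bsub>G\<^esub> h) - \<phi> n g * \<phi> n h)) \<longlonglongrightarrow> 0"
    "\<And>g. g \<in> carrier G - {\<one>\<^bsub>G\<^esub>} \<Longrightarrow> \<exists>c>0. \<forall>\<^sub>F n in sequentially. c \<le> nrm n (\<phi> n g - 1\<^sub>m n)"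
proof -
  from assms(1) obtain \<phi>' where \<phi>':
    "\<And>n. 1 \<le> n \<Longrightarrow> \<phi>' n \<in> carrier G \<rightarrow> unitary_matrices n"
    "\<And>g h. g \<in> carrier G \<Longrightarrow> h \<in> carrier G \<Longrightarrow> (\<lambda>n. nrm n (\<phi>' n (g \<otimes>\<^bsub>G\<^esub> h) - \<phi>' n g * \<phi>' n h)) \<longlonglongrightarrow> 0"
    "\<And>g. g \<in> carrier G - {\<one>\<^bsub>G\<^esub>} \<Longrightarrow> liminf (\<lambda>n. ereal (nrm n (\<phi>' n g - 1\<^sub>m n))) > 0"
    unfolding approximated_wrt_def by blast
  define \<phi> where "\<phi> n g = (if n = 0 then 1\<^sub>m 0 else \<phi>' n g)" for n g
  have "\<phi> n g \<in> unitary_matrices n" if "g \<in> carrier G" for n g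
    using \<phi>'(1)[of n] that unitary_matrices_one[of 0] by (cases "n = 0") (auto simp: \<phi>_def)
  moreover have "(\<lambda>n. nrm n (\<phi> n (g \<otimes>\<^bsub>G\<^esub> h) - \<phi> n g * \<phi> n h)) \<longlonglongrightarrow> 0"
    if "g \<in> carrier G" "h \<in> carrier G" for g h
    by (rule Lim_transform_eventually[OF \<phi>'(2)[OF that]])
      (use eventually_gt_at_top[of 0] in eventually_elim, simp add: \<phi>_def)
  moreover have "\<exists>c>0. \<forall>\<^sub>F n in sequentially. c \<le> nrm n (\<phi> n g - 1\<^sub>m n)"
    if "g \<in> carrier G - {\<one>\<^bsub>G\<^esub>}" for g
  proof -
    from \<phi>'(3)[OF that] obtain c where c: "c > 0" "\<forall>\<^sub>F n in sequentially. c \<le> nrm n (\<phi>' n g - 1\<^sub>m n)"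
      unfolding liminf_pos_iff by blast
    from c(2) eventually_gt_at_top[of 0] have "\<forall>\<^sub>F n in sequentially. c \<le> nrm n (\<phi> n g - 1\<^sub>m n)"
      by eventually_elim (simp add: \<phi>_def)
    then show ?thesis using c(1) by blast
  qed
  ultimately show ?thesis using that by blast
qed

lemma hyperlinearE:
  assumes "hyperlinear G" "group G"
  obtains \<phi> where "hs_asymptotic_rep G (\<lambda>n. n) \<phi>" "\<And>g. g \<in> carrier G - {\<one>\<^bsub>G\<^esub>} \<Longrightarrow> hs_separates (\<lambda>n. n) \<phi> g"
proof -
  obtain \<phi> where "\<And>n g. g \<in> carrier G \<Longrightarrow> \<phi> n g \<in> unitary_matrices n"
    "\<And>g h. g \<in> carrier G \<Longrightarrow> h \<in> carrier G \<Longrightarrow> (\<lambda>n. hs_norm n (\<phi> n (g \<otimes>\<^bsub>G\<^esub> h) - \<phi> n g * \<phi> n h)) \<longlonglongrightarrow> 0"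
    "\<And>g. g \<in> carrier G - {\<one>\<^bsub>G\<^esub>} \<Longrightarrow> \<exists>c>0. \<forall>\<^sub>F n in sequentially. c \<le> hs_norm n (\<phi> n g - 1\<^sub>m n)"
    using approximated_wrtE[OF assms(1)[unfolded hyperlinear_def] assms(2)] by blast
  then show ?thesis using that[of \<phi>] by (auto simp: hs_asymptotic_rep_def hs_separates_def)
qed

lemma hyperlinearI:
  assumes "hs_asymptotic_rep G (\<lambda>n. n) \<phi>" "\<And>g. g \<in> carrier G - {\<one>\<^bsub>G\<^esub>} \<Longrightarrow> hs_separates (\<lambda>n. n) \<phi> g"
  shows "hyperlinear G"
  unfolding hyperlinear_def approximated_wrt_def liminf_pos_iff
  using assms by (intro exI[of _ \<phi>]) (auto simp: hs_asymptotic_rep_def hs_separates_def)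

lemma MF_groupE:
  assumes "MF_group G" "group G"
  obtains \<phi> where "op_asymptotic_rep G (\<lambda>n. n) \<phi>"
    "\<And>g. g \<in> carrier G - {\<one>\<^bsub>G\<^esub>} \<Longrightarrow> \<exists>c>0. \<forall>\<^sub>F n in sequentially. \<not> op_bound (\<phi> n g - 1\<^sub>m n) c"
proof -
  interpret group G by (rule assms(2))
  obtain \<phi> where u: "\<And>n g. g \<in> carrier G \<Longrightarrow> \<phi> n g \<in> unitary_matrices n"
    and m: "\<And>g h. g \<in> carrier G \<Longrightarrow> h \<in> carrier G \<Longrightarrow> (\<lambda>n. op_norm n (\<phi> n (g \<otimes>\<^bsub>G\<^esub> h) - \<phi> n g * \<phi> n h)) \<longlonglongrightarrow> 0"
    and s: "\<And>g. g \<in> carrier G - {\<one>\<^bsub>G\<^esub>} \<Longrightarrow> \<exists>c>0. \<forall>\<^sub>F n in sequentially. c \<le> op_norm n (\<phi> n g - 1\<^sub>m n)"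
    using approximated_wrtE[OF assms(1)[unfolded MF_group_def] assms(2)] by blast
  have "op_asymptotic_rep G (\<lambda>n. n) \<phi>"
  proof
    fix g h n assume g: "g \<in> carrier G"
    show "\<phi> n g \<in> unitary_matrices n" by (rule u[OF g])
    assume h: "h \<in> carrier G"
    show "asymp_eq (\<lambda>n. n) (\<lambda>n. n) (\<lambda>n. \<phi> n (g \<otimes>\<^bsub>G\<^esub> h)) (\<lambda>n. \<phi> n g * \<phi> n h)"
      unfolding asymp_eq_def
    proof (intro conjI allI impI)
      show "bounded_seq (\<lambda>n. n) (\<lambda>n. n) (\<lambda>n. \<phi> n (g \<otimes>\<^bsub>G\<^esub> h))"
        using g h by (intro bounded_seq_unitary u) simp
      show "bounded_seq (\<lambda>n. n) (\<lambda>n. n) (\<lambda>n. \<phi> n g * \<phi> n h)"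
        by (rule bounded_seq_mult[OF bounded_seq_unitary[OF u[OF g]] bounded_seq_unitary[OF u[OF h]]])
      fix e :: real assume "e > 0"
      from order_tendstoD(2)[OF m[OF g h] this]
      show "\<forall>\<^sub>F n in sequentially. op_bound (\<phi> n (g \<otimes>\<^bsub>G\<^esub> h) - \<phi> n g * \<phi> n h) e"
      proof eventually_elim
        case (elim n)
        have "\<phi> n (g \<otimes>\<^bsub>G\<^esub> h) - \<phi> n g * \<phi> n h \<in> carrier_mat n n"
          by (rule minus_carrier_mat[OF mult_carrier_mat[OF unitary_matricesD(1)[OF u[OF g]] unitary_matricesD(1)[OF u[OF h]]]])
        from op_bound_mono[OF op_norm_bound[OF this]] elim show ?case by simp
      qed
    qed
  qed
  moreover have "\<exists>c>0. \<forall>\<^sub>F n in sequentially. \<not> op_bound (\<phi> n g - 1\<^sub>m n) c" if g: "g \<in> carrier G - {\<one>\<^bsub>G\<^esub>}" for g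
  proof -
    from s[OF g] obtain c where c: "c > 0" "\<forall>\<^sub>F n in sequentially. c \<le> op_norm n (\<phi> n g - 1\<^sub>m n)" by blast
    from c(2) have "\<forall>\<^sub>F n in sequentially. \<not> op_bound (\<phi> n g - 1\<^sub>m n) (c / 2)"
    proof eventually_elim
      case (elim n)
      show ?case
        using op_norm_le[OF minus_carrier_mat[OF one_carrier_mat], of "\<phi> n g" n "c / 2"] elim c(1) by auto
    qed
    then show ?thesis using c(1) by (intro exI[of _ "c / 2"]) auto
  qed
  ultimately show ?thesis using that by blast
qed

text \<open>
  An element far from \<open>1\<close> in operator norm may tend to \<open>1\<close> in the normalized
  Hilbert--Schmidt norm, namely if it moves only a small part of the space. Compression to the
  complement of the vectors fixed by its normal closure \<open>M\<close> discards the rest of the space.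
\<close>

lemma MF_group_hs_separates:
  assumes G: "group G" and MF: "MF_group G" and N: "N \<lhd> G" "finite N" and h: "h \<in> N" "h \<noteq> \<one>\<^bsub>G\<^esub>"
  obtains \<chi> where "hs_asymptotic_rep G (\<lambda>n. n) \<chi>" "hs_separates (\<lambda>n. n) \<chi> h"
proof -
  interpret G: group G by (rule G)
  have hG: "h \<in> carrier G" using h(1) N(1) by (meson normal_imp_subgroup subgroup.mem_carrier)
  define M where "M = \<Inter>{K. K \<lhd> G \<and> h \<in> K}"
  have "M \<subseteq> N" using N(1) h(1) by (auto simp: M_def)
  then have finM: "finite M" using N(2) finite_subset by blast
  have hM: "h \<in> M" by (auto simp: M_def)
  have "M \<lhd> G"
    unfolding G.normal_inv_iff
  proof (intro conjI ballI)
    show "subgroup M G"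
      unfolding M_def using N(1) h(1) by (intro G.subgroups_Inter) (auto intro: normal_imp_subgroup)
    fix x y assume "x \<in> carrier G" "y \<in> M"
    then show "x \<otimes>\<^bsub>G\<^esub> y \<otimes>\<^bsub>G\<^esub> inv\<^bsub>G\<^esub> x \<in> M" unfolding M_def by (auto simp: G.normal_inv_iff)
  qed
  obtain \<phi> where \<phi>: "op_asymptotic_rep G (\<lambda>n. n) \<phi>"
    and sep: "\<And>g. g \<in> carrier G - {\<one>\<^bsub>G\<^esub>} \<Longrightarrow> \<exists>c>0. \<forall>\<^sub>F n in sequentially. \<not> op_bound (\<phi> n g - 1\<^sub>m n) c"
    using MF_groupE[OF MF G] by blast
  interpret \<phi>: op_asymptotic_rep_normal G "\<lambda>n. n" \<phi> M
    using \<phi> \<open>M \<lhd> G\<close> finM by (simp add: op_asymptotic_rep_normal_def op_asymptotic_rep_normal_axioms_def)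
  obtain e \<psi> where \<psi>: "op_asymptotic_rep G e \<psi>" and e: "\<And>n. e n \<le> n"
    and sum_zero: "asymp_eq e e (\<lambda>n. mat_sum (e n) (e n) (\<psi> n) M) (\<lambda>n. 0\<^sub>m (e n) (e n))"
    and nz: "\<And>h c. h \<in> M \<Longrightarrow> 0 < c \<Longrightarrow> \<forall>\<^sub>F n in sequentially. \<not> op_bound (\<phi> n h - 1\<^sub>m n) c \<Longrightarrow>
       \<forall>\<^sub>F n in sequentially. e n \<noteq> 0"
    using \<phi>.compression by blast
  interpret \<psi>: op_asymptotic_rep G e \<psi> by (rule \<psi>)
  have e0: "\<forall>\<^sub>F n in sequentially. e n \<noteq> 0" using sep[of h] nz[OF hM] hG h(2) by blast
  have "hs_separates e \<psi> h"
    by (rule \<psi>.hs_separates_normal_generator[OF finM \<phi>.M_subset _ hG _ sum_zero e0]) (use hM in \<open>auto simp: M_def\<close>)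
  moreover obtain \<chi> where "hs_asymptotic_rep G (\<lambda>n. n) \<chi>"
    "\<And>g. g \<in> carrier G \<Longrightarrow> \<forall>\<^sub>F n in sequentially. e n \<noteq> 0 \<Longrightarrow> hs_separates e \<psi> g \<Longrightarrow> hs_separates (\<lambda>n. n) \<chi> g"
    using hs_amplification[OF \<psi>.hs_asymptotic_rep e G] by blast
  ultimately show ?thesis using that e0 hG by blast
qed

lemma hyperlinear_quotient_hs_separates:
  assumes G: "group G" and N: "N \<lhd> G" and H: "hyperlinear (G Mod N)"
  obtains \<chi> where "hs_asymptotic_rep G (\<lambda>n. n) \<chi>" "\<And>g. g \<in> carrier G - N \<Longrightarrow> hs_separates (\<lambda>n. n) \<chi> g"
proof -
  interpret normal N G by (rule N)
  obtain \<phi> where \<phi>: "hs_asymptotic_rep (G Mod N) (\<lambda>n. n) \<phi>"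
    and sep: "\<And>x. x \<in> carrier (G Mod N) - {\<one>\<^bsub>G Mod N\<^esub>} \<Longrightarrow> hs_separates (\<lambda>n. n) \<phi> x"
    using hyperlinearE[OF H factorgroup_is_group] by blast
  let ?p = "\<lambda>g. N #>\<^bsub>G\<^esub> g"
  have p: "?p g \<in> carrier (G Mod N)" if "g \<in> carrier G" for g
    using r_coset_hom_Mod that by (auto simp: hom_def)
  have pm: "?p (g \<otimes>\<^bsub>G\<^esub> h) = ?p g \<otimes>\<^bsub>G Mod N\<^esub> ?p h" if "g \<in> carrier G" "h \<in> carrier G" for g h
    using r_coset_hom_Mod that by (auto simp: hom_def)
  have "hs_asymptotic_rep G (\<lambda>n. n) (\<lambda>n g. \<phi> n (?p g))"
    unfolding hs_asymptotic_rep_def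
    using hs_asymptotic_repD(1)[OF \<phi> p] hs_asymptotic_repD(2)[OF \<phi> p p] by (simp add: pm)
  moreover have "hs_separates (\<lambda>n. n) (\<lambda>n g. \<phi> n (?p g)) g" if g: "g \<in> carrier G - N" for g
  proof -
    have "?p g \<noteq> N" using g rcos_self[of g] subgroup_axioms by (metis DiffD1 DiffD2 is_subgroup)
    then have "hs_separates (\<lambda>n. n) \<phi> (?p g)" using g p by (intro sep) auto
    then show ?thesis by (simp add: hs_separates_def)
  qed
  ultimately show ?thesis using that by blast
qed

theorem proposition1p6:
  fixes \<Gamma> :: "('a, 'b) monoid_scheme" and N :: "'a set"
  assumes "group \<Gamma>"
    and "finitely_generated_group \<Gamma>"
    and "N \<lhd> \<Gamma>"
    and "finite N"
    and "hyperlinear (\<Gamma> Mod N)"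
    and "MF_group \<Gamma>"
  shows "hyperlinear \<Gamma>"
proof -
  \<comment> \<open>The elements outside \<open>N\<close> come from the quotient; those of \<open>N\<close> are added one at a time.\<close>
  have "\<exists>\<chi>. hs_asymptotic_rep \<Gamma> (\<lambda>n. n) \<chi> \<and> (\<forall>g\<in>(carrier \<Gamma> - N) \<union> F. hs_separates (\<lambda>n. n) \<chi> g)"
    if "finite F" "F \<subseteq> N - {\<one>\<^bsub>\<Gamma>\<^esub>}" for F
    using that
  proof (induction F)
    case empty
    then show ?case using hyperlinear_quotient_hs_separates[OF assms(1,3,5)] by (metis Un_empty_right)
  next
    case (insert h F)
    then obtain \<phi> where \<phi>: "hs_asymptotic_rep \<Gamma> (\<lambda>n. n) \<phi>"
      "\<forall>g\<in>(carrier \<Gamma> - N) \<union> F. hs_separates (\<lambda>n. n) \<phi> g" by auto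
    obtain \<psi> where \<psi>: "hs_asymptotic_rep \<Gamma> (\<lambda>n. n) \<psi>" "hs_separates (\<lambda>n. n) \<psi> h"
      using MF_group_hs_separates[OF assms(1,6,3,4), of h] insert.prems by auto
    obtain \<chi> where \<chi>: "hs_asymptotic_rep \<Gamma> (\<lambda>n. n) \<chi>"
      "\<And>g. g \<in> carrier \<Gamma> \<Longrightarrow> hs_separates (\<lambda>n. n) \<phi> g \<or> hs_separates (\<lambda>n. n) \<psi> g \<Longrightarrow> hs_separates (\<lambda>n. n) \<chi> g"
      using hs_direct_sum[OF \<phi>(1) \<psi>(1) assms(1)] by blast
    have "N \<subseteq> carrier \<Gamma>" using normal_imp_subgroup[OF assms(3)] subgroup.subset by blast
    then have "\<forall>g\<in>(carrier \<Gamma> - N) \<union> insert h F. hs_separates (\<lambda>n. n) \<chi> g"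
      using \<phi>(2) \<psi>(2) \<chi>(2) insert.prems by blast
    then show ?case using \<chi>(1) by blast
  qed
  from this[of "N - {\<one>\<^bsub>\<Gamma>\<^esub>}"] assms(4) obtain \<chi> where "hs_asymptotic_rep \<Gamma> (\<lambda>n. n) \<chi>"
    "\<forall>g\<in>(carrier \<Gamma> - N) \<union> (N - {\<one>\<^bsub>\<Gamma>\<^esub>}). hs_separates (\<lambda>n. n) \<chi> g" by auto
  then show ?thesis by (intro hyperlinearI) auto
qed

end
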